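(* Let $p$ be a prime and $q=p^h$ with $h\in\mathbb{N}$. Let $f_1,\dots,f_s\in\mathbb{Z}_q[x_1,\dots,x_n]$ be nonzero polynomials, let $m_1,\dots,m_s\in\mathbb{N}$, and let $$V:=\{X\in T_q^n: f_k(X)\equiv0\pmod{p^{m_k}}\text{ for all }k\in[1,s]\}.$$ For each $k\in[1,s]$ let $f_k=\sum_{i=0}^\infty p^if_{k,i}$ be the Teichm\"uller expansion of $f_k$. Let $d_1,\dots,d_s\in\mathbb{N}$. If $\deg(f_{k,i})\leq d_kp^{h\lfloor i/h\rfloor}$ for all $i\in[0,m_k-1]$ and $k\in[1,s]$, then $$\mathrm{ord}_q(|V|)\geq\left\lceil\frac{n-\sum_{k=1}^s\frac{p^{m_k}-1}{p-1}d_k}{\max_{k\in[1,s]}\{p^{m_k-1}d_k\}}\right\rceil^*.$$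
   Context: $\mathbb{N}$ = positive integers, $[a,b]=\{x\in\mathbb{Z}:a\le x\le b\}$, $\lfloor x\rfloor$ is the floor. $\mathbb{Z}_q$ is the ring of integers of the unramified extension of $\mathbb{Q}_p$ of degree $h$ (residue field $\mathbb{F}_q$). $T_q\subset\mathbb{Z}_q$ is the set of Teichm\"uller representatives of $\mathbb{F}_q$ (i.e. $0$ together with the $(q-1)$-th roots of unity). A polynomial is a Teichm\"uller polynomial if all its coefficients lie in $T_q$; every $f\in\mathbb{Z}_q[x_1,\dots,x_n]$ has a unique Teichm\"uller expansion $f=\sum_{i\ge0}p^if_i$ with each $f_i$ a Teichm\"uller polynomial (from the expansions $\sum_ia_ip^i$, $a_i\in T_q$, of its coefficients). $\deg$ is total degree. $\mathrm{ord}_q$ is the $q$-adic valuation with $\mathrm{ord}_q(q)=1$. For $t\in\mathbb{R}$, $\lceil t\rceil^*$ is the least nonnegative integer $\geq t$. *)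

theory Defs
  imports
    "HOL-Analysis.Analysis"
    "HOL-Library.Poly_Mapping"
    "HOL-Computational_Algebra.Primes"
begin

text \<open>
  The unramified extension of degree \<open>h\<close> is the whole type \<open>'a\<close>. Its topology is the one given by
  the absolute value \<open>av\<close>, which extends the p-adic absolute value of the rationals.
  As \<open>'a\<close> is complete, the closure of the rationals in it is their completion
  for the p-adic absolute value, that is, the field of p-adic numbers.
\<close>

definition padic_numbers :: "'a::{field_char_0, complete_space} set" where
  "padic_numbers = closure (range of_rat)"

definition ring_of_integers :: "('a::field \<Rightarrow> real) \<Rightarrow> 'a set" where
  "ring_of_integers av = {x. av x \<le> 1}"

definition residue_field :: "('a::field \<Rightarrow> real) \<Rightarrow> 'a set set" where
  "residue_field av =
     ring_of_integers av //
       {(x, y). x \<in> ring_of_integers av \<and> y \<in> ring_of_integers av \<and> av (x - y) < 1}"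

definition has_degree_over :: "'a::field set \<Rightarrow> nat \<Rightarrow> bool" where
  "has_degree_over F h \<longleftrightarrow>
     (\<exists>B. finite B \<and> card B = h \<and>
        (\<forall>x. \<exists>!c. c \<in> B \<rightarrow>\<^sub>E F \<and> x = (\<Sum>b\<in>B. c b * b)))"

text \<open>
  Unramified means that the degree of the residue field over its prime field equals the degree
  \<open>h\<close> of the extension, that is, that the residue field has \<open>p ^ h\<close>
  elements. Separability of the residue field extension is automatic, finite fields being perfect.
\<close>

locale unramified_padic_extension =
  fixes p h :: nat and av :: "'a::{field_char_0, complete_space} \<Rightarrow> real"
  assumes prime_p: "prime p"
    and h_pos: "h \<ge> 1"
    and av_nonneg: "av x \<ge> 0"
    and av_eq_0_iff: "av x = 0 \<longleftrightarrow> x = 0"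
    and av_mult: "av (x * y) = av x * av y"
    and av_add: "av (x + y) \<le> max (av x) (av y)"
    and av_padic: "k \<noteq> 0 \<Longrightarrow> av (of_int k) = 1 / real p ^ multiplicity (int p) k"
    and dist_av: "dist x y = av (x - y)"
    and degree: "has_degree_over (padic_numbers :: 'a set) h"
    and unramified: "card (residue_field av) = p ^ h"

text \<open>
  A polynomial is a finitely supported map from monomials to coefficients, and a monomial is a
  finitely supported map from indices of variables to exponents. The variables of a polynomial in
  \<open>n\<close> variables have the indices \<open>1, \<dots>, n\<close>.
\<close>

type_synonym 'a mpol = "(nat \<Rightarrow>\<^sub>0 nat) \<Rightarrow>\<^sub>0 'a"

definition mpols :: "'a::zero set \<Rightarrow> nat \<Rightarrow> 'a mpol set" where
  "mpols R n = {f. \<forall>\<mu>\<in>Poly_Mapping.keys f.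
     Poly_Mapping.lookup f \<mu> \<in> R \<and> Poly_Mapping.keys \<mu> \<subseteq> {1..n}}"

definition mpol_eval :: "'a::comm_semiring_1 mpol \<Rightarrow> (nat \<Rightarrow> 'a) \<Rightarrow> 'a" where
  "mpol_eval f X =
     (\<Sum>\<mu>\<in>Poly_Mapping.keys f. Poly_Mapping.lookup f \<mu> *
        (\<Prod>j\<in>Poly_Mapping.keys \<mu>. X j ^ Poly_Mapping.lookup \<mu> j))"

text \<open>The zero polynomial gets total degree 0.\<close>

definition total_degree :: "'a::zero mpol \<Rightarrow> nat" where
  "total_degree f =
     Max (insert 0 ((\<lambda>\<mu>. \<Sum>j\<in>Poly_Mapping.keys \<mu>. Poly_Mapping.lookup \<mu> j) `
       Poly_Mapping.keys f))"

definition teich :: "nat \<Rightarrow> 'a::field set" where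
  "teich q = insert 0 {x. x ^ (q - 1) = 1}"

definition teich_poly :: "nat \<Rightarrow> 'a::field mpol \<Rightarrow> bool" where
  "teich_poly q g \<longleftrightarrow> (\<forall>\<mu>. Poly_Mapping.lookup g \<mu> \<in> teich q)"

definition teich_expansion ::
  "nat \<Rightarrow> nat \<Rightarrow> 'a::{field, topological_space} mpol \<Rightarrow> (nat \<Rightarrow> 'a mpol) \<Rightarrow> bool" where
  "teich_expansion p h f g \<longleftrightarrow>
     (\<forall>i. teich_poly (p ^ h) (g i)) \<and>
     (\<forall>\<mu>. (\<lambda>i. of_nat p ^ i * Poly_Mapping.lookup (g i) \<mu>) sums Poly_Mapping.lookup f \<mu>)"

definition solutions ::
  "('a::field \<Rightarrow> real) \<Rightarrow> nat \<Rightarrow> nat \<Rightarrow> nat \<Rightarrow> nat \<Rightarrow> (nat \<Rightarrow> 'a mpol) \<Rightarrow> (nat \<Rightarrow> nat) \<Rightarrow> (nat \<Rightarrow> 'a) set"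
where
  "solutions av p h n s f m =
     {X \<in> {1..n} \<rightarrow>\<^sub>E teich (p ^ h).
        \<forall>k\<in>{1..s}. \<exists>y\<in>ring_of_integers av. mpol_eval (f k) X = of_nat p ^ m k * y}"

text \<open>
  As \<open>q = p ^ h\<close>, the valuation with value 1 at \<open>q\<close> is the
  p-adic one divided by \<open>h\<close>; its values are rational in general.
\<close>

definition ord_q :: "nat \<Rightarrow> nat \<Rightarrow> nat \<Rightarrow> ereal" where
  "ord_q p h N = (if N = 0 then \<infinity> else ereal (real (multiplicity p N) / real h))"

definition ceiling_star :: "real \<Rightarrow> nat" where
  "ceiling_star t = (LEAST k. t \<le> real k)"

end

theory Submission
  imports Defs "HOL-Number_Theory.Cong" "HOL-Computational_Algebra.Polynomial"
begin

text \<open>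
  Two ideas combine. First, at a Teichmueller point the monomials of \<open>f\<close> take Teichmueller values, so
  \<open>f(X)\<close> is modulo a power of \<open>p\<close> a ghost component of Witt vectors; integral Witt polynomials \<open>s_e\<close>,
  isobaric of weight \<open>p ^ e\<close>, express divisibility of \<open>f(X)\<close> by \<open>p ^ m\<close> as \<open>s_e \<equiv> 0\<close> modulo \<open>p\<close> for
  \<open>e < m\<close>. Since \<open>x ^ q = x\<close> on Teichmueller points, the hypothesis on the degrees makes the degree of
  the \<open>e\<close>-th condition at most \<open>d * p ^ e\<close>, and these degrees add up to \<open>d * (p ^ m - 1) / (p - 1)\<close>.

  Second, the resulting system modulo \<open>p\<close> is handled by the theorem of Ax and Katz, with a proof that avoids
  Gauss sums: \<open>1 - z ^ ((q - 1) * p ^ M)\<close> is modulo \<open>p ^ (M + 1)\<close> the indicator of \<open>z \<equiv> 0\<close>. Its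
  multinomial coefficients have valuations given by digit sums (Legendre), which play the role
  of Stickelberger's theorem, and the sum of a monomial over all Teichmueller points vanishes unless all
  its exponents are divisible by \<open>q - 1\<close>.
\<close>

section \<open>Digit sums and multinomial coefficients\<close>

text \<open>With \<open>q = p ^ h\<close> and \<open>H = h * (t + 1)\<close>, the count is congruent
  modulo \<open>p ^ H\<close> to a signed sum over subsets of the conditions, so every multinomial
  term of every subset needs valuation at least \<open>H\<close>. A term gains factors
  \<open>p\<close> from its multinomial coefficients and a factor \<open>q\<close> from each
  variable with total exponent 0. Multiplying the exponents by \<open>p ^ r\<close> and reducing
  them modulo \<open>q - 1\<close> keeps the divisibility conditions intact, so one degree count,
  worth \<open>t + 1\<close>, is available for each \<open>r < h\<close>. Added up they give
  \<open>H\<close>, because the reduced exponents, summed over all \<open>r\<close>, are at most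
  \<open>(q - 1) / (p - 1)\<close> times the digit sum.

  A second obstacle is the field itself. It is given by a degree and by the size of its residue
  field, while the estimates need that an absolute value below 1 is at most \<open>1 / p\<close>.
  This comes from counting: by the degree there are at most \<open>p ^ h\<close> classes of integers
  modulo \<open>p\<close>, and they map onto \<open>p ^ h\<close> residue classes.\<close>

fun digit_sum :: "nat \<Rightarrow> nat \<Rightarrow> nat" where
  "digit_sum b n = (if n = 0 \<or> b < 2 then 0 else n mod b + digit_sum b (n div b))"

declare digit_sum.simps [simp del]

lemma digit_sum_0 [simp]: "digit_sum b 0 = 0"
  by (simp add: digit_sum.simps)

lemma digit_sum_rec: "b \<ge> 2 \<Longrightarrow> digit_sum b n = n mod b + digit_sum b (n div b)"
  by (cases "n = 0") (auto simp: digit_sum.simps[of b n])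

lemma digit_sum_append: "b \<ge> 2 \<Longrightarrow> r < b \<Longrightarrow> digit_sum b (b * n + r) = r + digit_sum b n"
  by (subst digit_sum_rec) auto

lemma digit_sum_mult_power: "b \<ge> 2 \<Longrightarrow> digit_sum b (b ^ k * n) = digit_sum b n"
proof (induction k)
  case (Suc k)
  then show ?case
    using digit_sum_append[of b 0 "b ^ k * n"] by (simp add: mult.assoc)
qed auto

lemma digit_sum_power_minus_1: "b \<ge> 2 \<Longrightarrow> digit_sum b (b ^ k - 1) = k * (b - 1)"
proof (induction k)
  case (Suc k)
  have "b ^ Suc k - 1 = b * (b ^ k - 1) + (b - 1)"
    using Suc.prems by (simp add: algebra_simps diff_mult_distrib2)
  then show ?case
    using Suc digit_sum_append[of b "b - 1" "b ^ k - 1"] by simp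
qed auto

text \<open>Adding 1 turns each trailing digit \<open>p - 1\<close> of \<open>n\<close> into 0 and
  raises the next digit by 1. There is one such trailing digit for each factor \<open>p\<close> of
  \<open>Suc n\<close>, and each costs \<open>p - 1\<close> in the digit sum.\<close>

lemma digit_sum_Suc:
  assumes "prime p"
  shows "(p - 1) * multiplicity p (Suc n) + digit_sum p (Suc n) = digit_sum p n + 1"
proof (induction n rule: less_induct)
  case (less n)
  have p: "p \<ge> 2"
    using assms prime_ge_2_nat by blast
  show ?case
  proof (cases "p dvd Suc n")
    case False
    then have "Suc n mod p = Suc (n mod p)" "Suc n div p = n div p"
      by (auto simp: mod_Suc div_Suc dvd_eq_mod_eq_0)
    then show ?thesis
      using False p digit_sum_rec[of p n] digit_sum_rec[of p "Suc n"]
      by (simp add: not_dvd_imp_multiplicity_0)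
  next
    case True
    then obtain k where k: "Suc n = p * k"
      by blast
    with p have "k > 0"
      by (cases k) auto
    then obtain l where l: "k = Suc l"
      using not0_implies_Suc by blast
    have n: "n = p * l + (p - 1)"
      using k l p by simp
    have "l < n"
    proof -
      have "2 * Suc l \<le> p * Suc l"
        using p by (intro mult_right_mono) auto
      then show ?thesis
        using k l by simp
    qed
    have "multiplicity p (Suc n) = Suc (multiplicity p k)"
      unfolding k using assms \<open>k > 0\<close> p by (simp add: multiplicity_times_same)
    moreover have "digit_sum p (Suc n) = digit_sum p k"
      unfolding k using digit_sum_append[of p 0 k] p by simp
    moreover have "digit_sum p n = p - 1 + digit_sum p l"
      unfolding n using digit_sum_append[of p "p - 1" l] p by simp
    ultimately show ?thesis
      using less.IH[OF \<open>l < n\<close>] l by simp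
  qed
qed

text \<open>Legendre's formula without subtraction: \<open>digit_sum_Suc\<close> telescopes along
  the factorial.\<close>

lemma multiplicity_fact:
  assumes "prime p"
  shows "(p - 1) * multiplicity p (fact n :: nat) + digit_sum p n = n"
proof (induction n)
  case (Suc n)
  have "multiplicity p (fact (Suc n) :: nat) = multiplicity p (Suc n) + multiplicity p (fact n :: nat)"
    unfolding fact_Suc of_nat_id using assms
    by (subst prime_elem_multiplicity_mult_distrib) (auto simp del: fact_Suc)
  then show ?case
    using Suc digit_sum_Suc[OF assms, of n] by (simp only: distrib_left)
qed auto

definition multinom :: "'b set \<Rightarrow> ('b \<Rightarrow> nat) \<Rightarrow> nat" where
  "multinom A k = fact (sum k A) div (\<Prod>x\<in>A. fact (k x))"

text \<open>Extensional functions with bounded values: the set is finite, and each choice of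
  exponents on \<open>A\<close> is counted once.\<close>

definition compositions :: "'b set \<Rightarrow> nat \<Rightarrow> ('b \<Rightarrow> nat) set" where
  "compositions A n = {k \<in> A \<rightarrow>\<^sub>E {..n}. sum k A = n}"

lemma finite_compositions: "finite A \<Longrightarrow> finite (compositions A n)"
  unfolding compositions_def by (rule finite_subset[of _ "A \<rightarrow>\<^sub>E {..n}"]) (auto intro: finite_PiE)

lemma prod_fact_dvd_fact_sum:
  "finite A \<Longrightarrow> (\<Prod>x\<in>A. fact (k x)) dvd (fact (sum k A) :: nat)"
proof (induction A rule: finite_induct)
  case (insert y A)
  have "fact (k y) * (\<Prod>x\<in>A. fact (k x)) dvd fact (k y) * (fact (sum k A) :: nat)"
    using insert by simp
  also have "\<dots> dvd fact (k y + sum k A)"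
    by (rule fact_fact_dvd_fact)
  finally show ?case
    using insert by simp
qed auto

lemma multinom_mult_prod_fact:
  "finite A \<Longrightarrow> multinom A k * (\<Prod>x\<in>A. fact (k x)) = fact (sum k A)"
  unfolding multinom_def using prod_fact_dvd_fact_sum by (metis dvd_div_mult_self)

lemma multinom_insert:
  assumes "finite A" "y \<notin> A"
  shows "multinom (insert y A) k = (sum k (insert y A) choose k y) * multinom A k"
proof -
  have "multinom (insert y A) k * (fact (k y) * (\<Prod>x\<in>A. fact (k x))) = fact (k y + sum k A)"
    using multinom_mult_prod_fact[of "insert y A" k] assms by simp
  also have "\<dots> = fact (k y) * fact (sum k A) * ((k y + sum k A) choose k y)"
    using binomial_fact_lemma[of "k y" "k y + sum k A"] by simp
  also have "\<dots> = ((k y + sum k A) choose k y) * multinom A k * (fact (k y) * (\<Prod>x\<in>A. fact (k x)))"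
    using multinom_mult_prod_fact[of A k] assms by (simp add: mult_ac)
  finally show ?thesis
    using assms by simp
qed

lemma sum_compositions_insert:
  fixes G :: "('b \<Rightarrow> nat) \<Rightarrow> 'r::comm_monoid_add"
  assumes "finite A" "y \<notin> A"
  shows "(\<Sum>k\<in>compositions (insert y A) n. G k) =
    (\<Sum>i\<le>n. \<Sum>k\<in>compositions A (n - i). G (k(y := i)))"
proof -
  have "(\<Sum>i\<le>n. \<Sum>k\<in>compositions A (n - i). G (k(y := i))) =
    (\<Sum>(i, k)\<in>(SIGMA i:{..n}. compositions A (n - i)). G (k(y := i)))"
    using assms by (subst sum.Sigma) (auto simp: finite_compositions)
  also have "\<dots> = (\<Sum>k\<in>compositions (insert y A) n. G k)"
  proof (rule sum.reindex_bij_witness[where i = "\<lambda>k. (k y, k(y := undefined))"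
        and j = "\<lambda>(i, k). k(y := i)"], goal_cases)
    case (1 a)
    then show ?case
      using assms by (auto simp: compositions_def PiE_def extensional_def fun_eq_iff)
  next
    case (2 a)
    obtain i k where a: "a = (i, k)" by force
    have "sum (k(y := i)) A = sum k A"
      using assms by (intro sum.cong) auto
    moreover have "\<And>x. x \<in> A \<Longrightarrow> k x \<le> n - i \<Longrightarrow> k x \<le> n"
      by simp
    ultimately show ?case
      using 2 assms unfolding a
      by (auto simp: compositions_def PiE_iff extensional_def)
  next
    case (3 k)
    then show ?case by simp
  next
    case (4 k)
    have s: "sum (k(y := undefined)) A = sum k A"
      using assms by (intro sum.cong) auto
    have "k x \<le> sum k A" if "x \<in> A" for x
      using that assms by (intro member_le_sum) auto
    then show ?case
      using 4 assms s
      by (auto simp: compositions_def PiE_iff extensional_def)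
  next
    case (5 k)
    then show ?case by (simp add: case_prod_beta)
  qed
  finally show ?thesis ..
qed

theorem multinomial_theorem:
  fixes a :: "'b \<Rightarrow> 'r::comm_semiring_1"
  assumes "finite A"
  shows "(\<Sum>x\<in>A. a x) ^ n = (\<Sum>k\<in>compositions A n. of_nat (multinom A k) * (\<Prod>x\<in>A. a x ^ k x))"
  using assms
proof (induction A arbitrary: n rule: finite_induct)
  case empty
  have "compositions {} n = (if n = 0 then {\<lambda>_. undefined} else {} :: ('b \<Rightarrow> nat) set)"
    by (auto simp: compositions_def)
  then show ?case
    by (auto simp: multinom_def power_0_left)
next
  case (insert y A)
  have "(\<Sum>x\<in>insert y A. a x) ^ n = (\<Sum>i\<le>n. of_nat (n choose i) * a y ^ i * (\<Sum>x\<in>A. a x) ^ (n - i))"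
    using insert binomial_ring[of "a y" "\<Sum>x\<in>A. a x" n] by simp
  also have "\<dots> = (\<Sum>i\<le>n. \<Sum>k\<in>compositions A (n - i). of_nat (n choose i) * a y ^ i *
      (of_nat (multinom A k) * (\<Prod>x\<in>A. a x ^ k x)))"
    by (simp add: insert.IH sum_distrib_left)
  also have "\<dots> = (\<Sum>i\<le>n. \<Sum>k\<in>compositions A (n - i). of_nat (multinom (insert y A) (k(y := i))) *
      (\<Prod>x\<in>insert y A. a x ^ (k(y := i)) x))"
  proof (intro sum.cong refl, goal_cases)
    case (1 i k)
    have "sum (k(y := i)) A = sum k A" "(\<Prod>x\<in>A. fact ((k(y := i)) x)) = (\<Prod>x\<in>A. fact (k x) :: nat)"
      using insert.hyps by (auto intro!: sum.cong prod.cong)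
    moreover have "(\<Prod>x\<in>A. a x ^ (k(y := i)) x) = (\<Prod>x\<in>A. a x ^ k x)"
      using insert.hyps by (auto intro!: prod.cong)
    moreover have "i + sum k A = n"
      using 1 by (auto simp: compositions_def)
    ultimately show ?case
      using insert.hyps by (simp add: multinom_insert multinom_def[of A] mult_ac)
  qed
  also have "\<dots> = (\<Sum>k\<in>compositions (insert y A) n. of_nat (multinom (insert y A) k) *
      (\<Prod>x\<in>insert y A. a x ^ k x))"
    by (rule sum_compositions_insert[OF insert.hyps, symmetric])
  finally show ?case .
qed

text \<open>Legendre's formula for all factorials involved: the terms \<open>sum k A\<close> cancel
  and only digit sums remain. This is Kummer's count of carries.\<close>

lemma multiplicity_multinom:
  assumes "prime p" "finite A"
  shows "(p - 1) * multiplicity p (multinom A k) + digit_sum p (sum k A) = (\<Sum>x\<in>A. digit_sum p (k x))"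
proof -
  have nz: "multinom A k \<noteq> 0"
    using multinom_mult_prod_fact[OF assms(2), of k] by (metis fact_nonzero mult_zero_left)
  have "multiplicity p (multinom A k) + (\<Sum>x\<in>A. multiplicity p (fact (k x) :: nat)) =
      multiplicity p (fact (sum k A) :: nat)"
    using assms nz unfolding multinom_mult_prod_fact[OF assms(2), of k, symmetric]
    by (subst prime_elem_multiplicity_mult_distrib)
      (auto intro: prime_elem_multiplicity_prod_distrib[symmetric])
  then have "(p - 1) * multiplicity p (multinom A k) +
      (\<Sum>x\<in>A. (p - 1) * multiplicity p (fact (k x) :: nat)) + digit_sum p (sum k A) = sum k A"
    using multiplicity_fact[OF assms(1), of "sum k A"]
    by (simp only: distrib_left[symmetric] sum_distrib_left[symmetric])
  moreover have "(\<Sum>x\<in>A. (p - 1) * multiplicity p (fact (k x) :: nat)) +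
      (\<Sum>x\<in>A. digit_sum p (k x)) = sum k A"
    unfolding sum.distrib[symmetric] by (simp only: multiplicity_fact[OF assms(1)])
  ultimately show ?thesis
    by linarith
qed

section \<open>Cyclic shifts of exponents modulo \<open>q - 1\<close>\<close>

text \<open>For \<open>m > 0\<close> a positive \<open>k\<close> is represented in
  \<open>{1..m}\<close> and not in \<open>{0..<m}\<close>: the exponents \<open>0\<close> and
  \<open>q - 1\<close> give different functions at the Teichmueller point 0, so a positive exponent
  must not be reduced to 0.\<close>

definition pos_residue :: "nat \<Rightarrow> nat \<Rightarrow> nat" where
  "pos_residue m k = (if k = 0 then 0 else Suc ((k - 1) mod m))"

lemma pos_residue_0 [simp]: "pos_residue m 0 = 0"
  by (simp add: pos_residue_def)

lemma pos_residue_eq_0_iff [simp]: "pos_residue m k = 0 \<longleftrightarrow> k = 0"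
  by (simp add: pos_residue_def)

lemma pos_residue_pos_iff [simp]: "0 < pos_residue m k \<longleftrightarrow> 0 < k"
  by (simp add: pos_residue_def)

lemma cong_pos_residue: "[pos_residue m k = k] (mod m)"
proof (cases k)
  case (Suc l)
  have "[l mod m + 1 = l + 1] (mod m)"
    by (intro cong_add) (auto simp: cong_def)
  then show ?thesis
    using Suc by (simp add: pos_residue_def)
qed (auto simp: cong_def)

lemma pos_residue_le: "[b = k] (mod m) \<Longrightarrow> b > 0 \<Longrightarrow> pos_residue m k \<le> b"
proof (cases k)
  case (Suc l)
  assume "[b = k] (mod m)" "b > 0"
  then obtain c where c: "b = Suc c"
    using not0_implies_Suc by blast
  have "[c + 1 = l + 1] (mod m)"
    using \<open>[b = k] (mod m)\<close> c Suc by simp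
  then have "[c = l] (mod m)"
    using cong_add_rcancel_nat by blast
  then have "l mod m = c mod m"
    by (simp add: cong_def)
  then show ?thesis
    using Suc c by (simp add: pos_residue_def)
qed auto

lemma pos_residue_cong: "[a = b] (mod m) \<Longrightarrow> a > 0 \<Longrightarrow> b > 0 \<Longrightarrow> pos_residue m a = pos_residue m b"
  by (intro antisym pos_residue_le) (auto intro: cong_trans[OF cong_pos_residue] cong_sym)

lemma pos_residue_id: "k \<le> m \<Longrightarrow> pos_residue m k = k"
  by (auto simp: pos_residue_def)

text \<open>For positive \<open>a\<close> and \<open>b\<close> the right side is a positive member
  of the residue class of \<open>a + b\<close>, and \<open>pos_residue\<close> picks the least
  one.\<close>

lemma pos_residue_add: "pos_residue m (a + b) \<le> pos_residue m a + pos_residue m b"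
proof (cases "a = 0 \<or> b = 0")
  case False
  then show ?thesis
    by (intro pos_residue_le cong_add cong_pos_residue) auto
qed auto

text \<open>For \<open>k < p ^ h\<close>, multiplication by \<open>p\<close> modulo
  \<open>p ^ h - 1\<close> rotates the \<open>h\<close> base \<open>p\<close> digits of
  \<open>k\<close>. Over the whole orbit each digit visits each position once, so the sum is
  \<open>(p ^ h - 1) / (p - 1)\<close> times the digit sum of \<open>k\<close>.\<close>

definition orbit_weight :: "nat \<Rightarrow> nat \<Rightarrow> nat \<Rightarrow> nat" where
  "orbit_weight p h k = (\<Sum>r<h. pos_residue (p ^ h - 1) (p ^ r * k))"

text \<open>Multiplying by \<open>p\<close> shifts the index \<open>r\<close> by one. The term that
  leaves, at \<open>r = 0\<close>, equals the one that enters, at \<open>r = h\<close>, because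
  \<open>p ^ h\<close> is 1 modulo \<open>p ^ h - 1\<close>.\<close>

lemma orbit_weight_mult:
  assumes "p \<ge> 2"
  shows "orbit_weight p h (p * k) = orbit_weight p h k"
proof -
  have "[p ^ h - 1 + 1 = 0 + 1] (mod p ^ h - 1)"
    by (intro cong_add) (auto simp: cong_def)
  then have "[p ^ h = 1] (mod p ^ h - 1)"
    using assms by simp
  then have "[p ^ h * k = 1 * k] (mod p ^ h - 1)"
    by (intro cong_mult cong_refl)
  then have "[p ^ h * k = k] (mod p ^ h - 1)"
    by simp
  then have e: "pos_residue (p ^ h - 1) (p ^ h * k) = pos_residue (p ^ h - 1) k"
    using assms by (cases "k = 0") (auto intro: pos_residue_cong)
  have "orbit_weight p h (p * k) + pos_residue (p ^ h - 1) k =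
      (\<Sum>r<Suc h. pos_residue (p ^ h - 1) (p ^ r * k))"
    unfolding sum.lessThan_Suc_shift orbit_weight_def by (simp add: mult_ac)
  also have "\<dots> = orbit_weight p h k + pos_residue (p ^ h - 1) k"
    using e by (simp add: orbit_weight_def)
  finally show ?thesis
    by simp
qed

lemma orbit_weight_add: "orbit_weight p h (a + b) \<le> orbit_weight p h a + orbit_weight p h b"
  unfolding orbit_weight_def sum.distrib[symmetric] distrib_left
  by (intro sum_mono pos_residue_add)

lemma orbit_weight_0 [simp]: "orbit_weight p h 0 = 0"
  by (simp add: orbit_weight_def)

text \<open>Each \<open>p ^ r\<close> with \<open>r < h\<close> is at most \<open>p ^ h - 1\<close>,
  hence its own residue, and the orbit sum is a geometric series.\<close>

lemma orbit_weight_1: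
  assumes "p \<ge> 2"
  shows "(p - 1) * orbit_weight p h 1 = p ^ h - 1"
proof -
  have "orbit_weight p h 1 = (\<Sum>r<h. p ^ r)"
    unfolding orbit_weight_def
  proof (intro sum.cong refl, goal_cases)
    case (1 r)
    then have "p ^ r < p ^ h"
      using assms by simp
    then show ?case
      by (intro trans[OF pos_residue_id]) auto
  qed
  moreover have "int (p - 1) * (\<Sum>r<h. int p ^ r) = int p ^ h - 1"
    using assms power_diff_1_eq[of "int p" h] by (simp add: of_nat_diff)
  then have "int ((p - 1) * (\<Sum>r<h. p ^ r)) = int (p ^ h - 1)"
    using assms by (simp add: of_nat_diff)
  ultimately show ?thesis
    by (simp only: of_nat_eq_iff)
qed

text \<open>Subadditivity and invariance under \<open>p\<close> are applied along the base
  \<open>p\<close> expansion: a digit \<open>c\<close> contributes at most \<open>c\<close> times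
  the weight of 1. For \<open>k\<close> beyond \<open>p ^ h - 1\<close> the reduction may lose
  weight, so only an inequality results.\<close>

lemma orbit_weight_le_digit_sum:
  assumes "p \<ge> 2"
  shows "(p - 1) * orbit_weight p h k \<le> (p ^ h - 1) * digit_sum p k"
proof -
  have scale: "orbit_weight p h c \<le> c * orbit_weight p h 1" for c
  proof (induction c)
    case (Suc c)
    then show ?case
      using orbit_weight_add[of p h 1 c] by simp
  qed auto
  have "orbit_weight p h k \<le> digit_sum p k * orbit_weight p h 1"
  proof (induction k rule: less_induct)
    case (less k)
    show ?case
    proof (cases "k = 0")
      case False
      then have "k div p < k"
        using assms by simp
      have "orbit_weight p h k \<le> orbit_weight p h (k mod p) + orbit_weight p h (p * (k div p))"
        using orbit_weight_add[of p h "k mod p" "p * (k div p)"] by simp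
      also have "\<dots> \<le> (k mod p) * orbit_weight p h 1 + digit_sum p (k div p) * orbit_weight p h 1"
        using scale less.IH[OF \<open>k div p < k\<close>] orbit_weight_mult[OF assms]
        by (metis add_mono)
      finally show ?thesis
        using digit_sum_rec[OF assms, of k] by (simp add: algebra_simps)
    qed auto
  qed
  then have "(p - 1) * orbit_weight p h k \<le> digit_sum p k * ((p - 1) * orbit_weight p h 1)"
    by (simp add: mult.left_commute)
  then show ?thesis
    unfolding orbit_weight_1[OF assms] by (simp add: mult.commute)
qed

text \<open>Here \<open>k i x\<close> are the exponents of a multinomial term, \<open>v i\<close> is
  the valuation of its coefficient, and \<open>w i x j\<close> is the exponent of variable
  \<open>j\<close> in a monomial. For each shift \<open>r\<close>, the reduced exponents
  \<open>\<rho>\<close> of condition \<open>i\<close> add up to \<open>(q - 1) * \<mu> r i\<close>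
  with \<open>\<mu> r i\<close> positive, and each variable outside the set \<open>Z\<close> of
  absent ones receives at least \<open>q - 1\<close>. Comparison with the degrees bounds
  \<open>n - card Z\<close> by the sum of \<open>D i * \<mu> r i\<close>. Summed over
  \<open>r\<close>, the \<open>\<mu> r i\<close> are controlled by digit sums, hence by
  \<open>v i\<close>.\<close>

lemma katz_exponent_bound:
  fixes k :: "'c \<Rightarrow> 'b \<Rightarrow> nat" and w :: "'c \<Rightarrow> 'b \<Rightarrow> nat \<Rightarrow> nat"
  assumes p: "p \<ge> 2" and h: "h \<ge> 1" and S: "finite S" and A: "\<And>i. i \<in> S \<Longrightarrow> finite (A i)"
    and total: "\<And>i. i \<in> S \<Longrightarrow> (\<Sum>x\<in>A i. k i x) = (p ^ h - 1) * p ^ M"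
    and w: "\<And>i x. i \<in> S \<Longrightarrow> x \<in> A i \<Longrightarrow> (\<Sum>j\<in>{1..n}. w i x j) \<le> D i"
    and D: "\<And>i. i \<in> S \<Longrightarrow> D i \<le> \<Delta>" "\<Delta> \<ge> 1"
    and t: "\<Delta> * t + (\<Sum>i\<in>S. D i) < n"
    and U: "\<And>j. j \<in> {1..n} \<Longrightarrow> (p ^ h - 1) dvd (\<Sum>i\<in>S. \<Sum>x\<in>A i. k i x * w i x j)"
    and v: "\<And>i. i \<in> S \<Longrightarrow> (p - 1) * v i + h * (p - 1) = (\<Sum>x\<in>A i. digit_sum p (k i x))"
  shows "h * (t + 1) \<le> (\<Sum>i\<in>S. v i) +
    h * card {j \<in> {1..n}. (\<Sum>i\<in>S. \<Sum>x\<in>A i. k i x * w i x j) = 0}"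
proof -
  define q where "q = p ^ h"
  have "p ^ 1 \<le> p ^ h"
    using h p by (intro power_increasing) auto
  then have q: "q \<ge> 2"
    using p by (simp add: q_def)
  define Z where "Z = {j \<in> {1..n}. (\<Sum>i\<in>S. \<Sum>x\<in>A i. k i x * w i x j) = 0}"
  define \<rho> where "\<rho> r i x = pos_residue (q - 1) (p ^ r * k i x)" for r i x
  define \<mu> where "\<mu> r i = (\<Sum>x\<in>A i. \<rho> r i x) div (q - 1)" for r i
  have \<mu>: "(\<Sum>x\<in>A i. \<rho> r i x) = (q - 1) * \<mu> r i" "\<mu> r i \<ge> 1" if "i \<in> S" for r i
  proof -
    have "[(\<Sum>x\<in>A i. \<rho> r i x) = (\<Sum>x\<in>A i. p ^ r * k i x)] (mod q - 1)"
      unfolding \<rho>_def by (intro cong_sum cong_pos_residue)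
    moreover have "(\<Sum>x\<in>A i. p ^ r * k i x) = (q - 1) * (p ^ r * p ^ M)"
      using total[OF that] by (simp add: sum_distrib_left[symmetric] q_def mult_ac)
    ultimately have "(q - 1) dvd (\<Sum>x\<in>A i. \<rho> r i x)"
      by (metis cong_0_iff cong_dvd_iff dvd_triv_left)
    then show eq: "(\<Sum>x\<in>A i. \<rho> r i x) = (q - 1) * \<mu> r i"
      by (simp add: \<mu>_def)
    have "(\<Sum>x\<in>A i. k i x) \<noteq> 0"
      using total[OF that] q p by (simp add: q_def)
    then obtain x where x: "x \<in> A i" "k i x \<noteq> 0"
      by (meson sum.not_neutral_contains_not_neutral)
    then have "\<rho> r i x \<noteq> 0"
      using p by (simp add: \<rho>_def)
    then have "(\<Sum>x\<in>A i. \<rho> r i x) \<noteq> 0"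
      using x A[OF that] by auto
    then show "\<mu> r i \<ge> 1"
      using eq by (cases "\<mu> r i") auto
  qed
  have step: "t + 1 + card S \<le> card Z + (\<Sum>i\<in>S. \<mu> r i)" for r
  proof -
    \<comment> \<open>Reduction keeps the total exponent a multiple of \<open>q - 1\<close>, and it
      stays positive because \<open>pos_residue\<close> vanishes only at 0.\<close>
    have ge: "q - 1 \<le> (\<Sum>i\<in>S. \<Sum>x\<in>A i. \<rho> r i x * w i x j)" if j: "j \<in> {1..n} - Z" for j
    proof (rule dvd_imp_le)
      have "[(\<Sum>i\<in>S. \<Sum>x\<in>A i. \<rho> r i x * w i x j) = (\<Sum>i\<in>S. \<Sum>x\<in>A i. p ^ r * k i x * w i x j)] (mod q - 1)"
        unfolding \<rho>_def by (intro cong_sum cong_mult cong_pos_residue cong_refl)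
      moreover have "(\<Sum>i\<in>S. \<Sum>x\<in>A i. p ^ r * k i x * w i x j) =
          p ^ r * (\<Sum>i\<in>S. \<Sum>x\<in>A i. k i x * w i x j)"
        by (simp add: sum_distrib_left mult_ac)
      moreover have "(q - 1) dvd p ^ r * (\<Sum>i\<in>S. \<Sum>x\<in>A i. k i x * w i x j)"
        using U[of j] j by (simp add: q_def)
      ultimately show "(q - 1) dvd (\<Sum>i\<in>S. \<Sum>x\<in>A i. \<rho> r i x * w i x j)"
        using cong_dvd_iff by fastforce
      have "(\<Sum>i\<in>S. \<Sum>x\<in>A i. k i x * w i x j) \<noteq> 0"
        using j by (auto simp: Z_def)
      then obtain i where i: "i \<in> S" "(\<Sum>x\<in>A i. k i x * w i x j) \<noteq> 0"
        by (meson sum.not_neutral_contains_not_neutral)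
      then obtain x where x: "x \<in> A i" "k i x * w i x j \<noteq> 0"
        by (meson sum.not_neutral_contains_not_neutral)
      have "\<rho> r i x * w i x j \<noteq> 0"
        using x p by (simp add: \<rho>_def)
      then have "(\<Sum>x\<in>A i. \<rho> r i x * w i x j) \<noteq> 0"
        using x A[OF i(1)] by auto
      then have "(\<Sum>i\<in>S. \<Sum>x\<in>A i. \<rho> r i x * w i x j) \<noteq> 0"
        using i(1) S by (auto simp only: sum_eq_0_iff)
      then show "0 < (\<Sum>i\<in>S. \<Sum>x\<in>A i. \<rho> r i x * w i x j)"
        by simp
    qed
    have "(q - 1) * (n - card Z) = (\<Sum>j\<in>{1..n} - Z. q - 1)"
      by (subst sum_constant, subst card_Diff_subset) (auto simp: Z_def)
    also have "\<dots> \<le> (\<Sum>j\<in>{1..n} - Z. \<Sum>i\<in>S. \<Sum>x\<in>A i. \<rho> r i x * w i x j)"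
      using ge by (rule sum_mono)
    also have "\<dots> \<le> (\<Sum>j\<in>{1..n}. \<Sum>i\<in>S. \<Sum>x\<in>A i. \<rho> r i x * w i x j)"
      by (intro sum_mono2) auto
    also have "\<dots> = (\<Sum>i\<in>S. \<Sum>x\<in>A i. \<rho> r i x * (\<Sum>j\<in>{1..n}. w i x j))"
      unfolding sum_distrib_left
      by (subst sum.swap, intro sum.cong refl, rule sum.swap)
    also have "\<dots> \<le> (\<Sum>i\<in>S. \<Sum>x\<in>A i. \<rho> r i x * D i)"
      using w by (intro sum_mono mult_left_mono) auto
    also have "\<dots> = (q - 1) * (\<Sum>i\<in>S. D i * \<mu> r i)"
      unfolding sum_distrib_left
      using \<mu>(1) by (intro sum.cong refl, simp only: sum_distrib_right[symmetric]) simp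
    finally have "n - card Z \<le> (\<Sum>i\<in>S. D i * \<mu> r i)"
      using q by simp
    \<comment> \<open>One unit of each \<open>\<mu> r i\<close> is paid by the sum of the
      \<open>D i\<close> in hypothesis \<open>t\<close>; only the excess is bounded through
      \<open>\<Delta>\<close>. As \<open>\<Delta> \<ge> 1\<close>, \<open>card Z\<close> can be
      counted at the same rate.\<close>
    also have "\<dots> = (\<Sum>i\<in>S. D i + D i * (\<mu> r i - 1))"
      using \<mu>(2) by (intro sum.cong refl) (simp add: diff_mult_distrib2)
    also have "\<dots> \<le> (\<Sum>i\<in>S. D i + \<Delta> * (\<mu> r i - 1))"
      using D by (intro sum_mono add_mono mult_right_mono) auto
    also have "\<dots> = (\<Sum>i\<in>S. D i) + \<Delta> * (\<Sum>i\<in>S. \<mu> r i - 1)"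
      by (simp add: sum.distrib sum_distrib_left)
    finally have "n \<le> card Z + (\<Sum>i\<in>S. D i) + \<Delta> * (\<Sum>i\<in>S. \<mu> r i - 1)"
      by simp
    moreover have "card Z \<le> \<Delta> * card Z"
      using D(2) by simp
    ultimately have "\<Delta> * t < \<Delta> * (card Z + (\<Sum>i\<in>S. \<mu> r i - 1))"
      using t unfolding distrib_left by linarith
    then have "t < card Z + (\<Sum>i\<in>S. \<mu> r i - 1)"
      by (rule mult_less_cancel1[THEN iffD1, THEN conjunct2])
    moreover have "(\<Sum>i\<in>S. \<mu> r i - 1) + card S = (\<Sum>i\<in>S. \<mu> r i)"
    proof -
      have "(\<Sum>i\<in>S. \<mu> r i - 1) + card S = (\<Sum>i\<in>S. \<mu> r i - 1 + 1)"
        by (simp only: sum.distrib sum_constant mult_1_right of_nat_id)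
      also have "\<dots> = (\<Sum>i\<in>S. \<mu> r i)"
        by (intro sum.cong refl le_add_diff_inverse2 \<mu>(2))
      finally show ?thesis .
    qed
    ultimately show ?thesis
      by linarith
  qed
  \<comment> \<open>The orbit sum of each exponent is bounded by its digit sum, and hypothesis
    \<open>v\<close> turns the digit sums into \<open>(p - 1) * (v i + h)\<close>.\<close>
  have v_ge: "(\<Sum>r<h. \<mu> r i) \<le> v i + h" if "i \<in> S" for i
  proof -
    have "(p - 1) * ((q - 1) * (\<Sum>r<h. \<mu> r i)) = (p - 1) * (\<Sum>r<h. \<Sum>x\<in>A i. \<rho> r i x)"
      by (simp add: \<mu>(1)[OF that] sum_distrib_left)
    also have "\<dots> = (\<Sum>x\<in>A i. (p - 1) * orbit_weight p h (k i x))"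
      unfolding \<rho>_def orbit_weight_def q_def by (subst sum.swap) (simp add: sum_distrib_left)
    also have "\<dots> \<le> (\<Sum>x\<in>A i. (q - 1) * digit_sum p (k i x))"
      unfolding q_def by (intro sum_mono orbit_weight_le_digit_sum p)
    also have "\<dots> = (p - 1) * ((q - 1) * (v i + h))"
      unfolding sum_distrib_left[symmetric] v[OF that, symmetric] by (simp only: distrib_left mult_ac)
    finally show ?thesis
      using p q by simp
  qed
  have "h * (t + 1 + card S) = (\<Sum>r<h. t + 1 + card S)"
    by simp
  also have "\<dots> \<le> (\<Sum>r<h. card Z + (\<Sum>i\<in>S. \<mu> r i))"
    by (intro sum_mono step)
  also have "\<dots> = h * card Z + (\<Sum>i\<in>S. \<Sum>r<h. \<mu> r i)"
    by (simp add: sum.distrib) (rule sum.swap)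
  also have "\<dots> \<le> h * card Z + (\<Sum>i\<in>S. v i + h)"
    by (intro add_mono sum_mono v_ge) auto
  finally have "h * (t + 1) + h * card S \<le> h * card Z + (\<Sum>i\<in>S. v i) + h * card S"
    by (simp add: sum.distrib algebra_simps)
  then show ?thesis
    by (simp add: Z_def)
qed

section \<open>Residues and Teichmueller representatives\<close>

text \<open>Gaussian elimination on the equations \<open>b\<close>. The field of coefficients is a
  set \<open>F\<close> with closure properties because the p-adic numbers are a subset of the type
  and not a type.\<close>

lemma homogeneous_system_solution:
  fixes F :: "'a::field set" and A :: "'i \<Rightarrow> 'b \<Rightarrow> 'a"
  assumes F: "1 \<in> F" "\<And>x y. x \<in> F \<Longrightarrow> y \<in> F \<Longrightarrow> x - y \<in> F"
      "\<And>x y. x \<in> F \<Longrightarrow> y \<in> F \<Longrightarrow> x * y \<in> F" "\<And>x y. x \<in> F \<Longrightarrow> y \<in> F \<Longrightarrow> x / y \<in> F"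
    and "finite B" "finite I" "card B < card I"
    and "\<And>i b. i \<in> I \<Longrightarrow> b \<in> B \<Longrightarrow> A i b \<in> F"
  shows "\<exists>c. (\<forall>i\<in>I. c i \<in> F) \<and> (\<exists>i\<in>I. c i \<noteq> 0) \<and> (\<forall>b\<in>B. (\<Sum>i\<in>I. c i * A i b) = 0)"
  using assms(5-)
proof (induction B arbitrary: I A rule: finite_induct)
  case empty
  then have "I \<noteq> {}"
    by auto
  then show ?case
    using F(1) by (intro exI[of _ "\<lambda>_. 1"]) auto
next
  case (insert b B)
  have zero: "0 \<in> F"
    using F(1) F(2)[of 1 1] by simp
  have minus: "- x \<in> F" if "x \<in> F" for x
    using F(2)[OF zero that] by simp
  have add: "x + y \<in> F" if "x \<in> F" "y \<in> F" for x y
    using F(2)[OF that(1) minus[OF that(2)]] by simp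
  have sum: "(\<Sum>i\<in>J. f i) \<in> F" if "\<And>i. i \<in> J \<Longrightarrow> f i \<in> F" for f and J :: "'i set"
    using that by (induction J rule: infinite_finite_induct) (auto simp: zero add)
  show ?case
  proof (cases "\<forall>i\<in>I. A i b = 0")
    case True
    have "\<exists>c. (\<forall>i\<in>I. c i \<in> F) \<and> (\<exists>i\<in>I. c i \<noteq> 0) \<and> (\<forall>b\<in>B. (\<Sum>i\<in>I. c i * A i b) = 0)"
      using insert.prems insert.hyps by (intro insert.IH) auto
    then show ?thesis
      using True by auto
  next
    case False
    then obtain l where l: "l \<in> I" "A l b \<noteq> 0"
      by blast
    \<comment> \<open>Row \<open>i\<close> minus the multiple of the pivot row \<open>l\<close> that
      clears column \<open>b\<close>.\<close>
    define A' where "A' i b' = A i b' - A i b / A l b * A l b'" for i b'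
    have "\<exists>c. (\<forall>i\<in>I - {l}. c i \<in> F) \<and> (\<exists>i\<in>I - {l}. c i \<noteq> 0) \<and>
        (\<forall>b\<in>B. (\<Sum>i\<in>I - {l}. c i * A' i b) = 0)"
      using insert.prems insert.hyps l(1)
      by (intro insert.IH) (auto simp: A'_def intro!: F)
    then obtain c where c: "\<And>i. i \<in> I - {l} \<Longrightarrow> c i \<in> F" "\<exists>i\<in>I - {l}. c i \<noteq> 0"
      "\<And>b. b \<in> B \<Longrightarrow> (\<Sum>i\<in>I - {l}. c i * A' i b) = 0"
      by blast
    \<comment> \<open>The value that equation \<open>b\<close> forces on the pivot unknown; with it
      the original system takes the reduced form \<open>A'\<close>.\<close>
    define cl where "cl = - (\<Sum>i\<in>I - {l}. c i * (A i b / A l b))"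
    define c' where "c' = c(l := cl)"
    have split: "(\<Sum>i\<in>I. c' i * A i b') = (\<Sum>i\<in>I - {l}. c i * A' i b')" for b'
    proof -
      have "(\<Sum>i\<in>I. c' i * A i b') = c' l * A l b' + (\<Sum>i\<in>I - {l}. c' i * A i b')"
        using l insert.prems by (intro sum.remove) auto
      also have "(\<Sum>i\<in>I - {l}. c' i * A i b') = (\<Sum>i\<in>I - {l}. c i * A i b')"
        by (intro sum.cong) (auto simp: c'_def)
      also have "c' l * A l b' = - (\<Sum>i\<in>I - {l}. c i * (A i b / A l b * A l b'))"
        by (simp add: c'_def cl_def sum_distrib_right mult.assoc)
      also have "\<dots> + (\<Sum>i\<in>I - {l}. c i * A i b') = (\<Sum>i\<in>I - {l}. c i * A' i b')"
        by (simp add: A'_def right_diff_distrib sum_subtractf)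
      finally show ?thesis .
    qed
    have "A' i b = 0" for i
      using l by (simp add: A'_def)
    then have "\<forall>b'\<in>insert b B. (\<Sum>i\<in>I. c' i * A i b') = 0"
      unfolding split using c(3) by auto
    moreover have "cl \<in> F"
      unfolding cl_def using c(1) insert.prems l by (intro minus sum F) auto
    then have "\<forall>i\<in>I. c' i \<in> F"
      using c(1) by (auto simp: c'_def)
    moreover have "\<exists>i\<in>I. c' i \<noteq> 0"
      using c(2) by (auto simp: c'_def)
    ultimately show ?thesis
      by blast
  qed
qed

lemma card_roots_of_unity_le:
  assumes "N > 0"
  shows "finite {x::'a::idom. x ^ N = 1}" "card {x::'a::idom. x ^ N = 1} \<le> N"
proof -
  define P where "P = monom 1 N - (1 :: 'a poly)"
  have "coeff P N = 1"
    using assms by (simp add: P_def)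
  then have "P \<noteq> 0"
    by auto
  have "degree P \<le> N"
    unfolding P_def by (intro degree_diff_le degree_monom_le) auto
  moreover have "{x. x ^ N = 1} = {x. poly P x = 0}"
    by (simp add: P_def poly_monom)
  ultimately show "finite {x::'a. x ^ N = 1}" "card {x::'a. x ^ N = 1} \<le> N"
    using poly_roots_finite[OF \<open>P \<noteq> 0\<close>] card_poly_roots_bound[OF \<open>P \<noteq> 0\<close>] by auto
qed

section \<open>The ultrametric absolute value and congruences modulo powers of p\<close>

context unramified_padic_extension
begin

lemma p_ge_2: "p \<ge> 2"
  using prime_p prime_ge_2_nat by blast

lemma q_ge_2: "p ^ h \<ge> 2"
proof -
  have "p ^ 1 \<le> p ^ h"
    using h_pos p_ge_2 by (intro power_increasing) auto
  then show ?thesis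
    using p_ge_2 by simp
qed

lemma inverse_p_power_mono: "k \<le> l \<Longrightarrow> 1 / real p ^ l \<le> 1 / real p ^ k"
  using p_ge_2 by (intro divide_left_mono power_increasing) auto

lemma inverse_p_less_1: "1 / real p < 1"
  using p_ge_2 by simp

lemma av_0 [simp]: "av 0 = 0"
  using av_eq_0_iff by blast

lemma av_1 [simp]: "av 1 = 1"
  using av_padic[of 1] by simp

lemma av_minus [simp]: "av (- x) = av x"
proof -
  have "av (- 1) * av (- 1) = 1"
    using av_mult[of "-1" "-1"] by simp
  then have "av (- 1) = 1"
    using power_eq_imp_eq_base[of "av (- 1)" 2 1] av_nonneg[of "-1"] by (simp add: power2_eq_square)
  then show ?thesis
    using av_mult[of "-1" x] by simp
qed

lemma av_minus_commute: "av (x - y) = av (y - x)"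
  using av_minus[of "x - y"] by simp

lemma av_power: "av (x ^ n) = av x ^ n"
  by (induction n) (auto simp: av_mult)

lemma av_prod: "av (\<Prod>x\<in>A. f x) = (\<Prod>x\<in>A. av (f x))"
  by (induction A rule: infinite_finite_induct) (auto simp: av_mult)

lemma av_divide: "y \<noteq> 0 \<Longrightarrow> av (x / y) = av x / av y"
  using av_mult[of "x / y" y] av_eq_0_iff[of y] by (simp add: field_simps)

lemma av_add_le: "av x \<le> e \<Longrightarrow> av y \<le> e \<Longrightarrow> av (x + y) \<le> e"
  using av_add[of x y] by linarith

lemma av_add_less: "av x < e \<Longrightarrow> av y < e \<Longrightarrow> av (x + y) < e"
  using av_add[of x y] by linarith

lemma av_diff_le: "av x \<le> e \<Longrightarrow> av y \<le> e \<Longrightarrow> av (x - y) \<le> e"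
  using av_add[of x "- y"] by simp

lemma av_diff_less: "av x < e \<Longrightarrow> av y < e \<Longrightarrow> av (x - y) < e"
  using av_add[of x "- y"] by simp

lemma av_diff_le_trans: "av (x - y) \<le> e \<Longrightarrow> av (y - z) \<le> e \<Longrightarrow> av (x - z) \<le> e"
  using av_add[of "x - y" "y - z"] by simp

lemma av_diff_less_trans: "av (x - y) < e \<Longrightarrow> av (y - z) < e \<Longrightarrow> av (x - z) < e"
  using av_add[of "x - y" "y - z"] by simp

lemma av_sum_le: "(\<And>x. x \<in> A \<Longrightarrow> av (f x) \<le> e) \<Longrightarrow> 0 \<le> e \<Longrightarrow> av (\<Sum>x\<in>A. f x) \<le> e"
  by (induction A rule: infinite_finite_induct) (auto intro!: av_add_le)

lemma av_mult_le: "av x \<le> d \<Longrightarrow> av y \<le> e \<Longrightarrow> av (x * y) \<le> d * e"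
  unfolding av_mult using av_nonneg[of x] av_nonneg[of y] by (intro mult_mono) linarith+

lemma av_mult_le_left: "av x \<le> 1 \<Longrightarrow> av y \<le> e \<Longrightarrow> av (x * y) \<le> e"
  using av_mult_le[of x 1 y e] by simp

lemma av_power_le_1: "av x \<le> 1 \<Longrightarrow> av (x ^ n) \<le> 1"
  unfolding av_power by (intro power_le_one av_nonneg)

lemma av_prod_le_1: "(\<And>x. x \<in> A \<Longrightarrow> av (f x) \<le> 1) \<Longrightarrow> av (\<Prod>x\<in>A. f x) \<le> 1"
  unfolding av_prod by (intro prod_le_1) (auto simp: av_nonneg)

text \<open>Ultrametric triangles are isosceles, the two longest sides being equal.\<close>

lemma av_eq_of_close: "av (x - y) < av x \<Longrightarrow> av y = av x"
  using av_add[of y "x - y"] av_add[of x "y - x"] av_minus_commute[of x y] by (simp add: max_def split: if_splits)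

lemma av_of_int_le_1: "av (of_int k) \<le> 1"
proof (cases "k = 0")
  case False
  then show ?thesis
    using av_padic[of k] p_ge_2 by (simp add: divide_le_eq_1)
qed auto

lemma av_of_nat_le_1: "av (of_nat k) \<le> 1"
  using av_of_int_le_1[of "int k"] by simp

lemma av_of_nat_p: "av (of_nat p) = 1 / real p"
proof -
  have "multiplicity (int p) (int p) = 1"
    using p_ge_2 by (intro multiplicity_self) auto
  then show ?thesis
    using av_padic[of "int p"] p_ge_2 by simp
qed

lemma av_of_nat_p_power: "av (of_nat p ^ k) = 1 / real p ^ k"
  by (simp add: av_power av_of_nat_p power_divide)

lemma av_of_int_le_iff: "av (of_int k) \<le> 1 / real p ^ n \<longleftrightarrow> int p ^ n dvd k"
proof (cases "k = 0")
  case False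
  have "av (of_int k) \<le> 1 / real p ^ n \<longleftrightarrow> real p ^ n \<le> real p ^ multiplicity (int p) k"
    unfolding av_padic[OF False] using p_ge_2 by (simp add: field_simps)
  also have "\<dots> \<longleftrightarrow> n \<le> multiplicity (int p) k"
    using p_ge_2 by simp
  also have "\<dots> \<longleftrightarrow> int p ^ n dvd k"
    using False p_ge_2 by (intro power_dvd_iff_le_multiplicity[symmetric]) auto
  finally show ?thesis .
qed auto

lemma av_of_int_le_inverse_p_iff: "av (of_int k) \<le> 1 / real p \<longleftrightarrow> int p dvd k"
  using av_of_int_le_iff[of k 1] by simp

lemma av_of_int_not_dvd: "\<not> int p dvd k \<Longrightarrow> av (of_int k) = 1"
  using av_padic[of k] by (cases "k = 0") (auto simp: not_dvd_imp_multiplicity_0)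

lemma dvd_of_av_of_nat_le: "av (of_nat N) \<le> 1 / real p ^ n \<Longrightarrow> p ^ n dvd N"
  using av_of_int_le_iff[of "int N" n] by (metis of_int_of_nat_eq of_nat_dvd_iff of_nat_power)

lemma av_of_nat_multiplicity_le: "p ^ n dvd N \<Longrightarrow> av (of_nat N) \<le> 1 / real p ^ n"
  using av_of_int_le_iff[of "int N" n] by (metis of_int_of_nat_eq of_nat_dvd_iff of_nat_power)

lemma av_power_diff:
  assumes "av x \<le> 1" "av y \<le> 1"
  shows "av (x ^ n - y ^ n) \<le> av (x - y)"
proof (induction n)
  case (Suc n)
  have "x ^ Suc n - y ^ Suc n = x * (x ^ n - y ^ n) + y ^ n * (x - y)"
    by (simp add: algebra_simps)
  also have "av \<dots> \<le> av (x - y)"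
    using assms Suc by (intro av_add_le av_mult_le_left av_power_le_1) auto
  finally show ?case .
qed (auto simp: av_nonneg)

text \<open>The cofactor of \<open>x - y\<close> in \<open>x ^ p - y ^ p\<close> becomes
  \<open>p * y ^ (p - 1)\<close> when each \<open>x ^ i\<close> is replaced by \<open>y ^ i\<close>,
  so it is divisible by \<open>p\<close>. The replacement needs agreement modulo \<open>p\<close> at
  the start, that is \<open>k \<ge> 1\<close>.\<close>

lemma av_power_p_diff:
  assumes "av x \<le> 1" "av y \<le> 1" "av (x - y) \<le> 1 / real p ^ k" "k \<ge> 1"
  shows "av (x ^ p - y ^ p) \<le> 1 / real p ^ Suc k"
proof -
  have "(\<Sum>i<p. y ^ (p - Suc i) * x ^ i) = (\<Sum>i<p. y ^ (p - Suc i) * (x ^ i - y ^ i)) + of_nat p * y ^ (p - 1)"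
  proof -
    have "(\<Sum>i<p. y ^ (p - Suc i) * y ^ i) = (\<Sum>i<p. y ^ (p - 1))"
      by (intro sum.cong refl) (simp add: power_add[symmetric])
    then show ?thesis
      by (simp add: right_diff_distrib sum_subtractf)
  qed
  moreover have "av ((\<Sum>i<p. y ^ (p - Suc i) * (x ^ i - y ^ i)) + of_nat p * y ^ (p - 1)) \<le> 1 / real p"
  proof (rule av_add_le)
    have "av (x ^ i - y ^ i) \<le> 1 / real p" for i
      using av_power_diff[OF assms(1,2), of i] assms(3) inverse_p_power_mono[OF assms(4)] by simp
    then show "av (\<Sum>i<p. y ^ (p - Suc i) * (x ^ i - y ^ i)) \<le> 1 / real p"
      by (intro av_sum_le av_mult_le_left av_power_le_1 assms) auto
    show "av (of_nat p * y ^ (p - 1)) \<le> 1 / real p"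
      using av_mult_le_left[OF av_power_le_1[OF assms(2)], of "of_nat p" "1 / real p" "p - 1"]
      by (simp add: av_of_nat_p mult.commute)
  qed
  ultimately have "av ((x - y) * (\<Sum>i<p. y ^ (p - Suc i) * x ^ i)) \<le> 1 / real p ^ k * (1 / real p)"
    using assms(3) by (intro av_mult_le) auto
  then show ?thesis
    by (simp add: power_diff_sumr2 mult.commute)
qed

lemma av_power_p_power_diff:
  assumes "av x \<le> 1" "av y \<le> 1" "av (x - y) \<le> 1 / real p"
  shows "av (x ^ (p ^ k) - y ^ (p ^ k)) \<le> 1 / real p ^ Suc k"
proof (induction k)
  case (Suc k)
  have "av ((x ^ (p ^ k)) ^ p - (y ^ (p ^ k)) ^ p) \<le> 1 / real p ^ Suc (Suc k)"
    using Suc assms by (intro av_power_p_diff av_power_le_1) auto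
  then show ?case
    by (simp add: power_mult[symmetric] mult.commute)
qed (use assms in auto)

lemma av_prod_diff_le:
  assumes "\<And>x. x \<in> A \<Longrightarrow> av (f x) \<le> 1" "\<And>x. x \<in> A \<Longrightarrow> av (g x) \<le> 1"
    "\<And>x. x \<in> A \<Longrightarrow> av (f x - g x) \<le> e" "e \<ge> 0"
  shows "av ((\<Prod>x\<in>A. f x) - (\<Prod>x\<in>A. g x)) \<le> e"
  using assms
proof (induction A rule: infinite_finite_induct)
  case (insert a A)
  have "(\<Prod>x\<in>insert a A. f x) - (\<Prod>x\<in>insert a A. g x) =
      f a * ((\<Prod>x\<in>A. f x) - (\<Prod>x\<in>A. g x)) + (\<Prod>x\<in>A. g x) * (f a - g a)"
    using insert.hyps by (simp add: algebra_simps)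
  also have "av \<dots> \<le> e"
    using insert by (intro av_add_le av_mult_le_left av_prod_le_1) auto
  finally show ?case .
qed auto

section \<open>The p-adic numbers as a subfield\<close>

lemma padic_approx:
  fixes c :: 'a
  assumes "c \<in> padic_numbers" "e > 0"
  obtains r where "av (c - of_rat r) < e"
  using assms unfolding padic_numbers_def closure_approachable dist_av
  by (metis av_minus_commute rangeE)

lemma padic_numbersI:
  fixes c :: 'a
  assumes "\<And>e. e > 0 \<Longrightarrow> \<exists>r. av (c - of_rat r) < e"
  shows "c \<in> padic_numbers"
  unfolding padic_numbers_def closure_approachable dist_av
  using assms av_minus_commute by (metis rangeI)

lemma padic_1: "(1::'a) \<in> padic_numbers"
  by (rule padic_numbersI) (metis av_0 diff_self of_rat_1)

lemma padic_diff:
  fixes c d :: 'a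
  assumes "c \<in> padic_numbers" "d \<in> padic_numbers"
  shows "c - d \<in> padic_numbers"
proof (rule padic_numbersI)
  fix e :: real
  assume "e > 0"
  obtain r where r: "av (c - of_rat r) < e"
    using padic_approx[OF assms(1) \<open>e > 0\<close>] .
  obtain s where s: "av (d - of_rat s) < e"
    using padic_approx[OF assms(2) \<open>e > 0\<close>] .
  have "(c - d) - of_rat (r - s) = (c - of_rat r) - (d - of_rat s)"
    by (simp add: of_rat_diff)
  then show "\<exists>r. av (c - d - of_rat r) < e"
    using av_diff_less[OF r s] by metis
qed

lemma padic_mult:
  fixes c d :: 'a
  assumes "c \<in> padic_numbers" "d \<in> padic_numbers"
  shows "c * d \<in> padic_numbers"
proof (rule padic_numbersI)
  fix e :: real
  assume "e > 0"
  \<comment> \<open>\<open>K\<close> bounds \<open>av c\<close> and also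
    \<open>av (of_rat s)\<close>, since the error \<open>e'\<close> is at most 1. As
    \<open>e'\<close> is at most \<open>e / K\<close>, both mixed products below stay under
    \<open>e\<close>.\<close>
  define K where "K = 1 + av c + av d"
  have K: "K \<ge> 1" "av c < K" "av d < K"
    using av_nonneg[of c] av_nonneg[of d] by (auto simp: K_def)
  define e' where "e' = min 1 (e / K)"
  have e': "e' > 0" "e' \<le> 1" "e' \<le> e / K"
    using \<open>e > 0\<close> K by (auto simp: e'_def)
  obtain r where r: "av (c - of_rat r) < e'"
    using padic_approx[OF assms(1) e'(1)] .
  obtain s where s: "av (d - of_rat s) < e'"
    using padic_approx[OF assms(2) e'(1)] .
  have prod: "av (x * y) < e" if "av x < K" "av y < e'" for x y
  proof -
    have "av (x * y) \<le> K * av y"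
      unfolding av_mult using that av_nonneg by (intro mult_right_mono) auto
    also have "\<dots> < K * e'"
      using that K by (intro mult_strict_left_mono) auto
    also have "\<dots> \<le> e"
      using e'(3) K by (simp add: field_simps)
    finally show ?thesis .
  qed
  have "of_rat s = d - (d - of_rat s)"
    by simp
  moreover have "av (d - (d - of_rat s)) < K"
    by (rule av_diff_less) (use K s e' in linarith)+
  ultimately have "av (of_rat s) < K"
    by simp
  have "c * d - of_rat (r * s) = c * (d - of_rat s) + of_rat s * (c - of_rat r)"
    by (simp add: of_rat_mult algebra_simps)
  also have "av \<dots> < e"
    by (intro av_add_less prod) fact+
  finally show "\<exists>r. av (c * d - of_rat r) < e"
    by blast
qed

lemma padic_inverse:
  fixes c :: 'a
  assumes "c \<in> padic_numbers"
  shows "inverse c \<in> padic_numbers"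
proof (cases "c = 0")
  case False
  then have "av c > 0"
    using av_eq_0_iff av_nonneg by (metis less_eq_real_def)
  show ?thesis
  proof (rule padic_numbersI)
    fix e :: real
    assume "e > 0"
    \<comment> \<open>The bound \<open>av c\<close> makes \<open>of_rat r\<close> as large as
      \<open>c\<close>, hence nonzero; the other bound absorbs the denominator
      \<open>c * of_rat r\<close>.\<close>
    then have "min (av c) (e * (av c * av c)) > 0"
      using \<open>av c > 0\<close> by simp
    then obtain r where r: "av (c - of_rat r) < min (av c) (e * (av c * av c))"
      using padic_approx[OF assms] by blast
    then have eq: "av (of_rat r) = av c"
      by (intro av_eq_of_close) auto
    then have "of_rat r \<noteq> (0::'a)"
      using \<open>av c > 0\<close> by auto
    then have "inverse c - of_rat (inverse r) = (of_rat r - c) / (c * of_rat r)"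
      using False unfolding of_rat_inverse by (simp add: field_simps)
    then have "av (inverse c - of_rat (inverse r)) = av (c - of_rat r) / (av c * av c)"
      using False \<open>of_rat r \<noteq> 0\<close> eq by (simp add: av_divide av_mult av_minus_commute)
    also have "\<dots> < e"
      using r \<open>av c > 0\<close> by (simp add: field_simps)
    finally show "\<exists>r. av (inverse c - of_rat r) < e"
      by blast
  qed
qed (use assms in auto)

lemma padic_divide: "(c::'a) \<in> padic_numbers \<Longrightarrow> d \<in> padic_numbers \<Longrightarrow> c / d \<in> padic_numbers"
  unfolding divide_inverse by (intro padic_mult padic_inverse)

text \<open>A rational \<open>a / b\<close> in lowest terms that is close to \<open>c\<close> has
  \<open>b\<close> prime to \<open>p\<close>, since otherwise \<open>p\<close> would divide
  \<open>a\<close> too. With an inverse \<open>u\<close> of \<open>b\<close> modulo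
  \<open>p\<close>, the integer \<open>u * a\<close> agrees with \<open>a / b\<close> modulo
  \<open>p\<close>.\<close>

lemma padic_integer_approx:
  fixes c :: 'a
  assumes "c \<in> padic_numbers" "av c \<le> 1"
  obtains k :: int where "av (c - of_int k) \<le> 1 / real p"
proof -
  have "1 / real p > 0"
    using p_ge_2 by simp
  then obtain r where r: "av (c - of_rat r) < 1 / real p"
    using padic_approx[OF assms(1)] by blast
  obtain a b where ab: "quotient_of r = (a, b)"
    by force
  then have b: "b > 0" "coprime a b" "r = of_int a / of_int b"
    by (auto simp: quotient_of_denom_pos quotient_of_coprime quotient_of_div)
  have r': "of_rat r = (of_int a / of_int b :: 'a)"
    using b by (simp add: of_rat_divide)
  have "of_rat r = c - (c - of_rat r)"
    by simp
  moreover have "av (c - (c - of_rat r)) \<le> 1"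
    by (rule av_diff_le) (use r inverse_p_less_1 assms(2) in linarith)+
  ultimately have r1: "av (of_int a) \<le> av (of_int b)"
    using b(1) av_eq_0_iff[of "of_int b"] av_nonneg[of "of_int b"] unfolding r'
    by (simp add: av_divide divide_le_eq_1)
  have ndvd: "\<not> int p dvd b"
  proof
    assume "int p dvd b"
    moreover from this have "int p dvd a"
      using r1 av_of_int_le_inverse_p_iff[of a] av_of_int_le_inverse_p_iff[of b] by simp
    ultimately have "int p dvd 1"
      using b(2) coprime_common_divisor by blast
    then have "\<not> prime (int p)"
      by (rule not_prime_unit)
    then show False
      using prime_p by simp
  qed
  then have "coprime b (int p)"
    using prime_imp_coprime[of "int p" b] prime_p by (simp add: coprime_commute)
  then obtain u where u: "[b * u = 1] (mod int p)"
    using cong_solve_coprime_int by blast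
  have "[b * u * a = 1 * a] (mod int p)"
    using u by (intro cong_mult cong_refl)
  then have dvd: "int p dvd b * (u * a) - a"
    by (simp only: cong_iff_dvd_diff mult.assoc mult_1_left)
  have "of_rat r - of_int (u * a) = - (of_int (b * (u * a) - a) / of_int b :: 'a)"
    unfolding r' using b(1) by (simp add: field_simps)
  also have "av \<dots> = av (of_int (b * (u * a) - a))"
    unfolding av_minus using b(1) av_of_int_not_dvd[OF ndvd] by (subst av_divide) auto
  also have "\<dots> \<le> 1 / real p"
    using dvd av_of_int_le_inverse_p_iff by blast
  finally have "av (c - of_int (u * a)) \<le> 1 / real p"
    using r less_imp_le by (blast intro: av_diff_le_trans[of c "of_rat r"])
  then show ?thesis
    using that by blast
qed

lemma padic_dependent:
  fixes v :: "'i \<Rightarrow> 'a"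
  assumes "finite I" "card I > h"
  obtains c where "\<And>i. i \<in> I \<Longrightarrow> c i \<in> padic_numbers" "\<exists>i\<in>I. c i \<noteq> 0" "(\<Sum>i\<in>I. c i * v i) = 0"
proof -
  obtain B where B: "finite B" "card B = h"
    "\<And>x::'a. \<exists>!c. c \<in> B \<rightarrow>\<^sub>E padic_numbers \<and> x = (\<Sum>b\<in>B. c b * b)"
    using degree unfolding has_degree_over_def by blast
  then have "\<exists>c. c \<in> B \<rightarrow>\<^sub>E padic_numbers \<and> x = (\<Sum>b\<in>B. c b * b)" for x
    by blast
  then obtain coord where coord: "\<And>x. coord x \<in> B \<rightarrow>\<^sub>E padic_numbers" "\<And>x. x = (\<Sum>b\<in>B. coord x b * b)"
    by metis
  have "coord x b \<in> padic_numbers" if "b \<in> B" for x b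
    using coord(1) that by (rule PiE_mem)
  then have "\<exists>c. (\<forall>i\<in>I. c i \<in> padic_numbers) \<and> (\<exists>i\<in>I. c i \<noteq> 0) \<and>
      (\<forall>b\<in>B. (\<Sum>i\<in>I. c i * coord (v i) b) = 0)"
    using assms B
    by (intro homogeneous_system_solution padic_1 padic_diff padic_mult padic_divide) auto
  then obtain c where c: "\<And>i. i \<in> I \<Longrightarrow> c i \<in> padic_numbers" "\<exists>i\<in>I. c i \<noteq> 0"
    "\<And>b. b \<in> B \<Longrightarrow> (\<Sum>i\<in>I. c i * coord (v i) b) = 0"
    by blast
  have "(\<Sum>i\<in>I. c i * v i) = (\<Sum>i\<in>I. c i * (\<Sum>b\<in>B. coord (v i) b * b))"
    using coord(2) by simp
  also have "\<dots> = (\<Sum>b\<in>B. (\<Sum>i\<in>I. c i * coord (v i) b) * b)"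
    unfolding sum_distrib_left sum_distrib_right by (subst sum.swap) (simp add: mult.assoc)
  also have "\<dots> = 0"
    using c(3) by simp
  finally show ?thesis
    using that c by blast
qed

text \<open>Dividing a p-adic relation by its largest coefficient makes all coefficients integral
  and one of them 1. Replacing them by integers congruent to them modulo \<open>p\<close> leaves a
  nontrivial relation modulo \<open>p\<close>.\<close>

lemma integer_dependent:
  fixes v :: "'i \<Rightarrow> 'a"
  assumes "finite I" "card I > h" and v: "\<And>i. i \<in> I \<Longrightarrow> av (v i) \<le> 1"
  obtains k :: "'i \<Rightarrow> int" where "\<exists>i\<in>I. \<not> int p dvd k i" "av (\<Sum>i\<in>I. of_int (k i) * v i) \<le> 1 / real p"
proof -
  obtain c where c: "\<And>i. i \<in> I \<Longrightarrow> c i \<in> padic_numbers" "\<exists>i\<in>I. c i \<noteq> 0" "(\<Sum>i\<in>I. c i * v i) = 0"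
    using padic_dependent[OF assms(1,2)] by metis
  have "I \<noteq> {}"
    using c(2) by blast
  then have "Max ((\<lambda>i. av (c i)) ` I) \<in> (\<lambda>i. av (c i)) ` I"
    using assms(1) by (intro Max_in) auto
  then obtain l where l: "l \<in> I" "av (c l) = Max ((\<lambda>i. av (c i)) ` I)"
    by auto
  then have le: "av (c i) \<le> av (c l)" if "i \<in> I" for i
    using that assms(1) by simp
  have nz: "c l \<noteq> 0"
    using c(2) le av_nonneg av_eq_0_iff by (metis order_antisym)
  then have pos: "av (c l) > 0"
    using av_nonneg[of "c l"] av_eq_0_iff[of "c l"] by linarith
  define c' where "c' i = c i / c l" for i
  have c': "c' i \<in> padic_numbers" "av (c' i) \<le> 1" if "i \<in> I" for i
    using that c(1) l(1) le[OF that] pos nz by (auto simp: c'_def av_divide divide_le_eq_1 intro!: padic_divide)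
  then have "\<exists>k::int. av (c' i - of_int k) \<le> 1 / real p" if "i \<in> I" for i
    using padic_integer_approx that by metis
  then obtain k :: "'i \<Rightarrow> int" where k: "\<And>i. i \<in> I \<Longrightarrow> av (c' i - of_int (k i)) \<le> 1 / real p"
    by metis
  have "\<not> int p dvd k l"
  proof
    assume "int p dvd k l"
    then have "av (of_int (k l)) \<le> 1 / real p"
      using av_of_int_le_inverse_p_iff by blast
    then have "av (c' l - of_int (k l) + of_int (k l)) \<le> 1 / real p"
      by (intro av_add_le k l)
    then show False
      using nz inverse_p_less_1 by (simp add: c'_def)
  qed
  moreover have "av (\<Sum>i\<in>I. of_int (k i) * v i) \<le> 1 / real p"
  proof -
    have "(\<Sum>i\<in>I. c' i * v i) = 0"
      using c(3) by (simp add: c'_def sum_divide_distrib[symmetric])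
    then have "(\<Sum>i\<in>I. of_int (k i) * v i) = - (\<Sum>i\<in>I. v i * (c' i - of_int (k i)))"
      by (simp add: algebra_simps sum_subtractf)
    then show ?thesis
      using k v by (simp del: sum_negf) (intro av_sum_le av_mult_le_left, auto)
  qed
  ultimately show ?thesis
    using that l(1) by blast
qed

section \<open>Residue classes, and p as a uniformizer\<close>

definition residue_class :: "'a \<Rightarrow> 'a set" where
  "residue_class x = {y. av y \<le> 1 \<and> av (x - y) < 1}"

lemma residue_field_eq: "residue_field av = residue_class ` {x. av x \<le> 1}"
  unfolding residue_field_def quotient_def ring_of_integers_def residue_class_def by auto

lemma residue_class_eq_iff:
  assumes "av x \<le> 1" "av y \<le> 1"
  shows "residue_class x = residue_class y \<longleftrightarrow> av (x - y) < 1"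
proof
  assume "residue_class x = residue_class y"
  moreover have "y \<in> residue_class y"
    using assms by (simp add: residue_class_def)
  ultimately have "y \<in> residue_class x"
    by blast
  then show "av (x - y) < 1"
    by (simp add: residue_class_def)
next
  assume "av (x - y) < 1"
  then have "av (x - z) < 1 \<longleftrightarrow> av (y - z) < 1" for z
    using av_diff_less_trans[of x y 1 z] av_diff_less_trans[of y x 1 z]
    unfolding av_minus_commute[of y x] by blast
  then show "residue_class x = residue_class y"
    by (simp add: residue_class_def)
qed

lemma finite_residue_field: "finite (residue_field av)"
  using unramified p_ge_2 by (intro card_ge_0_finite) simp

text \<open>\<open>indep\<close> says that an integer combination of the \<open>v l\<close> is
  divisible by \<open>p\<close> only if all its coefficients are. \<open>integer_dependent\<close>
  bounds the length of such a family by \<open>h\<close>; when none of length \<open>Suc i\<close>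
  exists, one of length \<open>i\<close> spans modulo \<open>p\<close>.\<close>

lemma residue_coordinates:
  obtains i v where "i \<le> h" "\<And>l::nat. l < i \<Longrightarrow> av (v l) \<le> 1"
    "\<And>x. av x \<le> 1 \<Longrightarrow> \<exists>k::nat \<Rightarrow> int. av (x - (\<Sum>l<i. of_int (k l) * v l)) \<le> 1 / real p"
proof -
  define indep where "indep i v \<longleftrightarrow> (\<forall>l<i. av (v l) \<le> 1) \<and>
    (\<forall>k::nat \<Rightarrow> int. av (\<Sum>l<i. of_int (k l) * v l) \<le> 1 / real p \<longrightarrow> (\<forall>l<i. int p dvd k l))" for i v
  have bound: "i \<le> h" if iv: "indep i v" for i v
  proof (rule ccontr)
    assume "\<not> i \<le> h"
    then obtain k :: "nat \<Rightarrow> int" where "\<exists>l\<in>{..<i}. \<not> int p dvd k l" "av (\<Sum>l<i. of_int (k l) * v l) \<le> 1 / real p"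
      using iv by (auto simp: indep_def intro: integer_dependent[of "{..<i}" v])
    then show False
      using iv unfolding indep_def by blast
  qed
  have "\<exists>v. indep 0 v"
    by (simp add: indep_def)
  moreover have "\<not> (\<exists>v. indep (Suc h) v)"
    using bound by fastforce
  ultimately obtain i where "\<exists>v. indep i v" "\<not> (\<exists>v. indep (Suc i) v)"
    using nat_induct[of "\<lambda>i. \<exists>v. indep i v" "Suc h"] by blast
  then obtain v where v: "indep i v" "\<And>v'. \<not> indep (Suc i) v'"
    by blast
  have "\<exists>k::nat \<Rightarrow> int. av (x - (\<Sum>l<i. of_int (k l) * v l)) \<le> 1 / real p" if x: "av x \<le> 1" for x
  proof (rule ccontr)
    assume contra: "\<nexists>k::nat \<Rightarrow> int. av (x - (\<Sum>l<i. of_int (k l) * v l)) \<le> 1 / real p"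
    have "indep (Suc i) (v(i := x))"
      unfolding indep_def
    proof (intro conjI allI impI)
      fix l assume "l < Suc i"
      then show "av ((v(i := x)) l) \<le> 1"
        using v(1) x by (auto simp: indep_def less_Suc_eq)
    next
      fix k :: "nat \<Rightarrow> int" and l
      assume k: "av (\<Sum>l<Suc i. of_int (k l) * (v(i := x)) l) \<le> 1 / real p" and l: "l < Suc i"
      have eq: "(\<Sum>l<Suc i. of_int (k l) * (v(i := x)) l) = (\<Sum>l<i. of_int (k l) * v l) + of_int (k i) * x"
        by simp
      \<comment> \<open>Otherwise \<open>k i\<close> is invertible modulo \<open>p\<close> and the
        relation can be solved for \<open>x\<close>, against \<open>contra\<close>.\<close>
      have "int p dvd k i"
      proof (rule ccontr)
        assume "\<not> int p dvd k i"
        then have "coprime (k i) (int p)"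
          using prime_imp_coprime[of "int p" "k i"] prime_p by (simp add: coprime_commute)
        then obtain u where u: "[k i * u = 1] (mod int p)"
          using cong_solve_coprime_int by blast
        then have "int p dvd k i * u - 1"
          by (simp add: cong_iff_dvd_diff)
        then have "av (of_int (k i * u - 1)) \<le> 1 / real p"
          using av_of_int_le_inverse_p_iff by blast
        then have "av (x * of_int (k i * u - 1)) \<le> 1 / real p"
          by (intro av_mult_le_left x)
        moreover have "av (of_int u * ((\<Sum>l<i. of_int (k l) * v l) + of_int (k i) * x)) \<le> 1 / real p"
          using k unfolding eq by (intro av_mult_le_left av_of_int_le_1)
        ultimately have "av (of_int u * ((\<Sum>l<i. of_int (k l) * v l) + of_int (k i) * x) -
            x * of_int (k i * u - 1)) \<le> 1 / real p"
          by (intro av_diff_le)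
        moreover have "of_int u * ((\<Sum>l<i. of_int (k l) * v l) + of_int (k i) * x) -
            x * of_int (k i * u - 1) = x - (\<Sum>l<i. of_int (- u * k l) * v l)"
          by (simp add: algebra_simps sum_distrib_left sum_negf)
        ultimately show False
          using contra by metis
      qed
      moreover have "int p dvd k l" if "l < i"
      proof -
        have "av (x * of_int (k i)) \<le> 1 / real p"
          using \<open>int p dvd k i\<close> av_of_int_le_inverse_p_iff by (intro av_mult_le_left x) blast
        then have "av ((\<Sum>l<i. of_int (k l) * v l) + of_int (k i) * x - x * of_int (k i)) \<le> 1 / real p"
          using k unfolding eq by (intro av_diff_le)
        then have "av (\<Sum>l<i. of_int (k l) * v l) \<le> 1 / real p"
          by (simp add: mult.commute)
        then show ?thesis
          using v(1) that unfolding indep_def by blast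
      qed
      ultimately show "int p dvd k l"
        using l by (auto simp: less_Suc_eq)
    qed
    then show False
      using v(2) by blast
  qed
  then show ?thesis
    using that[of i v] bound[OF v(1)] v(1) unfolding indep_def by blast
qed

text \<open>Unramifiedness makes \<open>p\<close> generate the maximal ideal. There are at most
  \<open>p ^ i\<close> classes modulo \<open>p\<close>, with \<open>i \<le> h\<close>, and they map
  onto the \<open>p ^ h\<close> residue classes. The map is therefore injective, and what is 0 in
  the residue field is 0 modulo \<open>p\<close>.\<close>

lemma av_less_1_imp_le:
  assumes "av z < 1"
  shows "av z \<le> 1 / real p"
proof -
  obtain i v where i: "i \<le> h" and v: "\<And>l::nat. l < i \<Longrightarrow> av (v l) \<le> 1"
    and span: "\<And>x. av x \<le> 1 \<Longrightarrow> \<exists>k::nat \<Rightarrow> int. av (x - (\<Sum>l<i. of_int (k l) * v l)) \<le> 1 / real p"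
    using residue_coordinates by blast
  define comb where "comb k = (\<Sum>l<i. of_int (k l) * v l)" for k :: "nat \<Rightarrow> int"
  have comb_int: "av (comb k) \<le> 1" for k
    unfolding comb_def using v by (intro av_sum_le av_mult_le_left av_of_int_le_1) auto
  \<comment> \<open>Reducing the coordinates modulo \<open>p\<close> changes a combination by a
    multiple of \<open>p\<close> only; \<open>restrict\<close> puts the result into the finite set
    \<open>dom\<close> defined below.\<close>
  define red where "red k = restrict (\<lambda>l. k l mod int p) {..<i}" for k :: "nat \<Rightarrow> int"
  have red: "av (comb k - comb (red k)) \<le> 1 / real p" for k
  proof -
    have "comb k - comb (red k) = (\<Sum>l<i. v l * of_int (k l - k l mod int p))"
      by (simp add: comb_def red_def sum_subtractf[symmetric] algebra_simps)
    also have "av \<dots> \<le> 1 / real p"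
    proof (intro av_sum_le av_mult_le_left)
      show "av (of_int (k l - k l mod int p)) \<le> 1 / real p" for l
        unfolding av_of_int_le_inverse_p_iff by (rule dvd_minus_mod)
    qed (use v in auto)
    finally show ?thesis .
  qed
  define dom where "dom = {..<i} \<rightarrow>\<^sub>E {0..<int p}"
  have red_dom: "red k \<in> dom" for k
    using p_ge_2 by (auto simp: red_def dom_def)
  define \<Phi> where "\<Phi> k = residue_class (comb k)" for k
  have "residue_field av \<subseteq> \<Phi> ` dom"
  proof
    fix C assume "C \<in> residue_field av"
    then obtain x where x: "av x \<le> 1" "C = residue_class x"
      by (auto simp: residue_field_eq)
    obtain k where "av (x - comb k) \<le> 1 / real p"
      using span[OF x(1)] unfolding comb_def by blast
    then have "av (x - comb (red k)) \<le> 1 / real p"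
      using red by (rule av_diff_le_trans)
    then have "C = \<Phi> (red k)"
      unfolding x(2) \<Phi>_def residue_class_eq_iff[OF x(1) comb_int] using inverse_p_less_1 by linarith
    then show "C \<in> \<Phi> ` dom"
      using red_dom by blast
  qed
  \<comment> \<open>\<open>card dom\<close> is \<open>p ^ i\<close>, at most \<open>p ^ h\<close>,
    so the surjection forces equality and hence injectivity.\<close>
  then have "p ^ h \<le> card (\<Phi> ` dom)"
    unfolding unramified[symmetric] by (intro card_mono) (auto simp: dom_def finite_PiE)
  moreover have "card dom = p ^ i"
    unfolding dom_def by (simp add: card_PiE)
  moreover have "p ^ i \<le> p ^ h"
    using i p_ge_2 by (intro power_increasing) auto
  moreover have "finite dom"
    by (auto simp: dom_def finite_PiE)
  moreover from this have "card (\<Phi> ` dom) \<le> card dom"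
    by (rule card_image_le)
  ultimately have inj: "inj_on \<Phi> dom"
    by (intro eq_card_imp_inj_on) auto
  obtain k where k: "av (z - comb k) \<le> 1 / real p"
    using span[of z] assms unfolding comb_def by auto
  have "comb (red (\<lambda>_. 0)) = 0"
    by (simp add: comb_def red_def)
  moreover have "av (comb (red k)) < 1"
  proof -
    have "av (z - (z - comb (red k))) < 1"
      by (rule av_diff_less) (use av_diff_le_trans[OF k red] inverse_p_less_1 assms in linarith)+
    then show ?thesis
      by simp
  qed
  ultimately have "\<Phi> (red k) = \<Phi> (red (\<lambda>_. 0))"
    unfolding \<Phi>_def residue_class_eq_iff[OF comb_int comb_int] by simp
  then have "red k = red (\<lambda>_. 0)"
    using inj red_dom by (meson inj_onD)
  then have "comb (red k) = 0"
    using \<open>comb (red (\<lambda>_. 0)) = 0\<close> by simp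
  then have "av (comb k) \<le> 1 / real p"
    using red[of k] by simp
  then have "av (z - comb k + comb k) \<le> 1 / real p"
    by (intro av_add_le k)
  then show ?thesis
    by simp
qed

text \<open>Multiplication by the unit \<open>x\<close> permutes the nonzero residue classes;
  comparing the products of their representatives and cancelling gives the claim.
  \<open>av_less_1_imp_le\<close> sharpens each congruence to one modulo \<open>p\<close>.\<close>

lemma residue_fermat:
  assumes "av x = 1"
  shows "av (x ^ (p ^ h - 1) - 1) \<le> 1 / real p"
proof -
  define C where "C = residue_field av - {residue_class 0}"
  define r where "r c = (SOME y. y \<in> c)" for c :: "'a set"
  have fin: "finite C"
    using finite_residue_field by (simp add: C_def)
  have card: "card C = p ^ h - 1"
    unfolding C_def unramified[symmetric] residue_field_eq
    by (subst card_Diff_singleton) auto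
  have r: "av (r c) = 1" "residue_class (r c) = c" if "c \<in> C" for c
  proof -
    obtain y where y: "av y \<le> 1" "c = residue_class y"
      using \<open>c \<in> C\<close> by (auto simp: C_def residue_field_eq)
    then have "y \<in> c"
      by (simp add: residue_class_def)
    then have "r c \<in> c"
      unfolding r_def by (rule someI)
    then have "av (r c) \<le> 1" "av (y - r c) < 1"
      by (auto simp: y residue_class_def)
    then show eq: "residue_class (r c) = c"
      using y by (simp add: residue_class_eq_iff av_minus_commute)
    have "residue_class (r c) \<noteq> residue_class 0"
      using \<open>c \<in> C\<close> eq by (auto simp: C_def)
    then show "av (r c) = 1"
      using \<open>av (r c) \<le> 1\<close> residue_class_eq_iff[of "r c" 0] by simp
  qed
  define g where "g c = residue_class (x * r c)" for c
  have g_C: "g c \<in> C" if "c \<in> C" for c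
    using r[OF that] assms residue_class_eq_iff[of "x * r c" 0]
    by (auto simp: C_def g_def residue_field_eq av_mult)
  have "inj_on g C"
  proof (rule inj_onI)
    fix c c' assume c: "c \<in> C" "c' \<in> C" "g c = g c'"
    then have "av (x * (r c - r c')) < 1"
      using r assms by (simp add: g_def residue_class_eq_iff av_mult right_diff_distrib)
    then have "av (r c - r c') < 1"
      by (simp add: av_mult assms)
    then show "c = c'"
      using c r residue_class_eq_iff[of "r c" "r c'"] by simp
  qed
  then have "bij_betw g C C"
    using endo_inj_surj[OF fin, of g] g_C by (auto simp: bij_betw_def)
  then have eq: "(\<Prod>c\<in>C. r (g c)) = (\<Prod>c\<in>C. r c)"
    by (rule prod.reindex_bij_betw)
  have "av ((\<Prod>c\<in>C. r (g c)) - (\<Prod>c\<in>C. x * r c)) \<le> 1 / real p"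
  proof (rule av_prod_diff_le)
    fix c assume c: "c \<in> C"
    have "residue_class (r (g c)) = residue_class (x * r c)"
      using r(2)[OF g_C[OF c]] by (simp add: g_def)
    then have "av (r (g c) - x * r c) < 1"
      using r(1)[OF g_C[OF c]] r(1)[OF c] assms by (subst (asm) residue_class_eq_iff) (auto simp: av_mult)
    then show "av (r (g c) - x * r c) \<le> 1 / real p"
      by (rule av_less_1_imp_le)
    show "av (r (g c)) \<le> 1" "av (x * r c) \<le> 1"
      using r(1)[OF g_C[OF c]] r(1)[OF c] assms by (auto simp: av_mult)
  qed auto
  also have "(\<Prod>c\<in>C. r (g c)) - (\<Prod>c\<in>C. x * r c) = (\<Prod>c\<in>C. r c) * (1 - x ^ (p ^ h - 1))"
    unfolding eq using card by (simp add: prod.distrib algebra_simps)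
  finally have "av (\<Prod>c\<in>C. r c) * av (1 - x ^ (p ^ h - 1)) \<le> 1 / real p"
    by (simp add: av_mult)
  moreover have "av (\<Prod>c\<in>C. r c) = 1"
    using r(1) by (simp add: av_prod)
  ultimately show ?thesis
    by (simp add: av_minus_commute)
qed

lemma unit_power_close_to_1:
  assumes "av x = 1"
  shows "av (x ^ ((p ^ h - 1) * p ^ k) - 1) \<le> 1 / real p ^ Suc k"
  using av_power_p_power_diff[OF _ _ residue_fermat[OF assms], of k] assms
  by (simp add: av_power power_mult)

section \<open>Teichmueller representatives and their power sums\<close>

lemma inverse_p_power_tendsto_0: "e > 0 \<Longrightarrow> \<exists>n. 1 / real p ^ n < e"
  using real_arch_pow_inv[of e "1 / real p"] inverse_p_less_1 by (simp add: power_divide)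

text \<open>For a unit \<open>x\<close> the representative is the limit of
  \<open>x ^ (q ^ n)\<close>; for a nonunit it is 0.\<close>

lemma teich_exists:
  assumes "av x \<le> 1"
  obtains t where "t \<in> teich (p ^ h)" "av (t - x) < 1"
proof (cases "av x < 1")
  case True
  then show ?thesis
    using that[of 0] by (simp add: teich_def)
next
  case False
  then have x: "av x = 1"
    using assms by simp
  define q where "q = p ^ h"
  define y where "y n = x ^ (q ^ n)" for n
  have q_pow: "q ^ n = p ^ (h * n)" for n
    by (simp add: q_def power_mult)
  have y1: "av (y n) = 1" for n
    using x by (simp add: y_def av_power)
  \<comment> \<open>\<open>x ^ q\<close> and \<open>x\<close> agree modulo \<open>p\<close> by
    \<open>residue_fermat\<close>; raising both to the power \<open>p ^ (h * n)\<close> adds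
    \<open>h * n\<close> factors \<open>p\<close> to the difference.\<close>
  have step: "av (y (Suc n) - y n) \<le> 1 / real p ^ Suc n" for n
  proof -
    have "av (x * (x ^ (q - 1) - 1)) \<le> 1 / real p"
      using residue_fermat[OF x] x by (intro av_mult_le_left) (auto simp: q_def)
    moreover have "x * x ^ (q - 1) = x ^ q"
      using power_minus_mult[of q x] q_ge_2 by (simp only: q_def mult.commute)
    ultimately have "av (x ^ q - x) \<le> 1 / real p"
      by (simp add: right_diff_distrib)
    then have "av ((x ^ q) ^ (p ^ (h * n)) - x ^ (p ^ (h * n))) \<le> 1 / real p ^ Suc (h * n)"
      using x by (intro av_power_p_power_diff) (auto simp: av_power)
    also have "\<dots> \<le> 1 / real p ^ Suc n"
      using h_pos by (intro inverse_p_power_mono) simp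
    finally show ?thesis
      by (simp add: y_def q_pow[symmetric] power_mult[symmetric])
  qed
  have close: "av (y (n + k) - y n) \<le> 1 / real p ^ Suc n" for n k
  proof (induction k)
    case (Suc k)
    have "av (y (n + Suc k) - y (n + k)) \<le> 1 / real p ^ Suc n"
      using step[of "n + k"] inverse_p_power_mono[of "Suc n" "Suc (n + k)"] by simp
    then show ?case
      using Suc by (rule av_diff_le_trans)
  qed auto
  have "Cauchy y"
    unfolding Cauchy_altdef2 dist_av
  proof (intro allI impI)
    fix e :: real
    assume "e > 0"
    then obtain N where N: "1 / real p ^ N < e"
      using inverse_p_power_tendsto_0 by blast
    have "av (y n - y N) < e" if n: "n \<ge> N" for n
    proof -
      have "n = N + (n - N)"
        using n by simp
      then have "av (y n - y N) \<le> 1 / real p ^ Suc N"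
        using close[of N "n - N"] by metis
      also have "\<dots> \<le> 1 / real p ^ N"
        by (intro inverse_p_power_mono) simp
      finally show ?thesis
        using N by simp
    qed
    then show "\<exists>N. \<forall>n\<ge>N. av (y n - y N) < e"
      by blast
  qed
  then obtain t where t: "y \<longlonglongrightarrow> t"
    using Cauchy_convergent convergent_def by blast
  have near: "\<exists>n\<ge>N. av (t - y n) < e" if e: "e > 0" for e N
  proof -
    obtain M where M: "\<And>n. n \<ge> M \<Longrightarrow> dist (y n) t < e"
      using t e unfolding lim_sequentially by blast
    then have "dist (y (max M N)) t < e"
      by simp
    then show ?thesis
      unfolding dist_av av_minus_commute[of "y _"] by (intro exI[of _ "max M N"]) auto
  qed
  obtain n where n: "av (t - y n) < 1"
    using near[of 1 0] by auto
  then have t1: "av t \<le> 1"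
    using y1[of n] av_add_le[of "t - y n" 1 "y n"] by simp
  \<comment> \<open>The powers \<open>y m ^ (q - 1)\<close> tend to 1 by
    \<open>unit_power_close_to_1\<close>, so a positive distance of \<open>t ^ (q - 1)\<close> from
    1 is contradicted by some large \<open>m\<close>.\<close>
  have "av (t ^ (q - 1) - 1) = 0"
  proof (rule ccontr)
    assume "av (t ^ (q - 1) - 1) \<noteq> 0"
    then have pos: "av (t ^ (q - 1) - 1) > 0"
      using av_nonneg[of "t ^ (q - 1) - 1"] by simp
    then obtain N where N: "1 / real p ^ N < av (t ^ (q - 1) - 1)"
      using inverse_p_power_tendsto_0 by blast
    obtain m where m: "m \<ge> N" "av (t - y m) < av (t ^ (q - 1) - 1)"
      using near[OF pos] by blast
    have "y m ^ (q - 1) = x ^ ((p ^ h - 1) * p ^ (h * m))"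
      by (simp add: y_def power_mult[symmetric] q_pow[symmetric] mult.commute) (simp add: q_def)
    then have "av (y m ^ (q - 1) - 1) \<le> 1 / real p ^ Suc (h * m)"
      using unit_power_close_to_1[OF x] by simp
    also have "\<dots> \<le> 1 / real p ^ N"
    proof -
      have "1 * m \<le> h * m"
        using h_pos by (intro mult_right_mono) auto
      then show ?thesis
        using m(1) by (intro inverse_p_power_mono) linarith
    qed
    finally have "av (y m ^ (q - 1) - 1) < av (t ^ (q - 1) - 1)"
      using N by simp
    moreover have "av (t ^ (q - 1) - y m ^ (q - 1)) < av (t ^ (q - 1) - 1)"
      using av_power_diff[of t "y m" "q - 1"] t1 y1 m(2) by simp
    ultimately show False
      using av_diff_less_trans by blast
  qed
  then have "t \<in> teich (p ^ h)"
    by (simp add: av_eq_0_iff teich_def q_def)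
  moreover have "av (y n - x) < 1"
  proof -
    have "av (y (0 + n) - y 0) \<le> 1 / real p"
      using close[of 0 n] by simp
    then show ?thesis
      using inverse_p_less_1 by (simp add: y_def)
  qed
  then have "av (t - x) < 1"
    using n av_diff_less_trans by blast
  ultimately show ?thesis
    using that by blast
qed

lemma zero_notin_roots_of_unity: "0 \<notin> {x::'a. x ^ (p ^ h - 1) = 1}"
  using q_ge_2 by (simp add: power_0_left)

lemma finite_teich: "finite (teich (p ^ h) :: 'a set)"
  unfolding teich_def using card_roots_of_unity_le(1)[of "p ^ h - 1"] q_ge_2 by simp

lemma av_teich: "t \<in> teich (p ^ h) \<Longrightarrow> t \<noteq> 0 \<Longrightarrow> av t = 1"
proof -
  assume "t \<in> teich (p ^ h)" "t \<noteq> 0"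
  then have "av t ^ (p ^ h - 1) = 1"
    by (auto simp: teich_def av_power[symmetric])
  then show ?thesis
    using power_eq_imp_eq_base[of "av t" "p ^ h - 1" 1] av_nonneg[of t] q_ge_2 by simp
qed

lemma av_teich_le_1: "t \<in> teich (p ^ h) \<Longrightarrow> av t \<le> 1"
  using av_teich by (cases "t = 0") auto

text \<open>Each of the \<open>p ^ h\<close> residue classes contains a Teichmueller representative,
  which bounds the number of roots from below; the degree of the polynomial bounds it from
  above.\<close>

lemma card_roots_of_unity: "card {x::'a. x ^ (p ^ h - 1) = 1} = p ^ h - 1"
proof -
  have "residue_field av \<subseteq> residue_class ` teich (p ^ h)"
  proof
    fix C assume "C \<in> residue_field av"
    then obtain x where x: "av x \<le> 1" "C = residue_class x"
      by (auto simp: residue_field_eq)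
    obtain t where t: "t \<in> teich (p ^ h)" "av (t - x) < 1"
      using teich_exists[OF x(1)] .
    then have "C = residue_class t"
      using x av_teich_le_1 by (simp add: residue_class_eq_iff av_minus_commute)
    then show "C \<in> residue_class ` teich (p ^ h)"
      using t by blast
  qed
  then have "card (residue_field av) \<le> card (teich (p ^ h) :: 'a set)"
    by (rule surj_card_le[OF finite_teich])
  then have "p ^ h \<le> card (teich (p ^ h) :: 'a set)"
    unfolding unramified .
  also have "\<dots> = Suc (card {x::'a. x ^ (p ^ h - 1) = 1})"
    unfolding teich_def using zero_notin_roots_of_unity card_roots_of_unity_le(1)[of "p ^ h - 1"] q_ge_2
    by (subst card_insert_disjoint) auto
  finally show ?thesis
    using card_roots_of_unity_le(2)[of "p ^ h - 1", where ?'a = 'a] q_ge_2 by linarith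
qed

text \<open>For \<open>u = 0\<close> the point 0 contributes \<open>0 ^ 0 = 1\<close>, whence
  \<open>p ^ h\<close> instead of \<open>p ^ h - 1\<close>. If \<open>p ^ h - 1\<close> does not
  divide \<open>u\<close>, multiplication by a root \<open>g\<close> with \<open>g ^ u\<close>
  different from 1 permutes the roots and multiplies the sum by \<open>g ^ u\<close>, so the sum is
  0.\<close>

lemma sum_teich_power:
  "(\<Sum>t\<in>teich (p ^ h). t ^ u :: 'a) =
     (if u = 0 then of_nat (p ^ h) else if (p ^ h - 1) dvd u then of_nat (p ^ h - 1) else 0)"
proof -
  define N where "N = p ^ h - 1"
  define R where "R = {x::'a. x ^ N = 1}"
  have N: "N > 0"
    using q_ge_2 by (simp add: N_def)
  have R: "finite R" "card R = N" "0 \<notin> R"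
    using card_roots_of_unity_le(1)[OF N, where ?'a = 'a] card_roots_of_unity zero_notin_roots_of_unity
    by (auto simp: R_def N_def)
  have split: "(\<Sum>t\<in>teich (p ^ h). t ^ u) = 0 ^ u + (\<Sum>t\<in>R. t ^ u)"
    using R by (simp add: teich_def R_def N_def)
  show ?thesis
  proof (cases "N dvd u")
    case True
    then have "t ^ u = 1" if "t \<in> R" for t
      using that by (auto simp: R_def power_mult)
    then have "(\<Sum>t\<in>R. t ^ u) = of_nat N"
      using R by simp
    then show ?thesis
      using True q_ge_2 unfolding split by (auto simp: N_def of_nat_diff)
  next
    case False
    define r where "r = u mod N"
    have r: "0 < r" "r < N"
      using False N by (auto simp: r_def dvd_eq_mod_eq_0)
    have pow: "t ^ u = t ^ r" if "t \<in> R" for t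
    proof -
      have "t ^ u = t ^ (N * (u div N) + r)"
        by (simp add: r_def)
      also have "\<dots> = t ^ r"
        using that by (simp add: R_def power_add power_mult)
      finally show ?thesis .
    qed
    \<comment> \<open>Otherwise a polynomial of degree \<open>r < N\<close> would have
      \<open>N\<close> roots.\<close>
    have "\<exists>g\<in>R. g ^ r \<noteq> 1"
    proof (rule ccontr)
      assume "\<not> (\<exists>g\<in>R. g ^ r \<noteq> 1)"
      then have "R \<subseteq> {x. x ^ r = 1}"
        by blast
      then have "card R \<le> r"
        using card_roots_of_unity_le[OF r(1), where ?'a = 'a] by (meson card_mono order_trans)
      then show False
        using R r by simp
    qed
    then obtain g where g: "g \<in> R" "g ^ r \<noteq> 1"
      by blast
    then have "g \<noteq> 0"
      using R by blast
    have "bij_betw (\<lambda>t. g * t) R R"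
    proof (rule bij_betw_byWitness[where f' = "\<lambda>t. t / g"])
      show "(*) g ` R \<subseteq> R" "(\<lambda>t. t / g) ` R \<subseteq> R"
        using g \<open>g \<noteq> 0\<close> by (auto simp: R_def power_mult_distrib power_divide)
    qed (use \<open>g \<noteq> 0\<close> in auto)
    then have "(\<Sum>t\<in>R. (g * t) ^ r) = (\<Sum>t\<in>R. t ^ r)"
      by (rule sum.reindex_bij_betw)
    then have "g ^ r * (\<Sum>t\<in>R. t ^ r) = (\<Sum>t\<in>R. t ^ r)"
      by (simp only: power_mult_distrib sum_distrib_left)
    then have "(g ^ r - 1) * (\<Sum>t\<in>R. t ^ r) = 0"
      by (simp only: left_diff_distrib mult_1_left diff_self)
    then have "(\<Sum>t\<in>R. t ^ u) = 0"
      using g pow by simp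
    then show ?thesis
      using False unfolding split by (cases "u = 0") (auto simp: N_def)
  qed
qed

end

section \<open>Witt components over the integers\<close>

text \<open>The values \<open>\<phi>\<close> of the monomials are arbitrary, so that the same notion
  serves for substituting Teichmueller terms and for the Frobenius lift.\<close>

definition int_poly_eval :: "(('v \<Rightarrow>\<^sub>0 nat) \<Rightarrow> 'r) \<Rightarrow> (('v \<Rightarrow>\<^sub>0 nat) \<Rightarrow>\<^sub>0 int) \<Rightarrow> 'r::comm_ring_1" where
  "int_poly_eval \<phi> f = (\<Sum>\<mu>\<in>Poly_Mapping.keys f. of_int (Poly_Mapping.lookup f \<mu>) * \<phi> \<mu>)"

lemma int_poly_eval_superset:
  assumes "finite A" "Poly_Mapping.keys f \<subseteq> A"
  shows "int_poly_eval \<phi> f = (\<Sum>\<mu>\<in>A. of_int (Poly_Mapping.lookup f \<mu>) * \<phi> \<mu>)"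
  unfolding int_poly_eval_def using assms
  by (intro sum.mono_neutral_left) (auto simp: in_keys_iff)

lemma int_poly_eval_0 [simp]: "int_poly_eval \<phi> 0 = 0"
  by (simp add: int_poly_eval_def)

lemma int_poly_eval_single [simp]:
  "int_poly_eval \<phi> (Poly_Mapping.single \<mu> c) = of_int c * \<phi> \<mu>"
  by (simp add: int_poly_eval_superset[of "{\<mu>}"])

lemma int_poly_eval_add: "int_poly_eval \<phi> (f + g) = int_poly_eval \<phi> f + int_poly_eval \<phi> g"
proof -
  define A where "A = Poly_Mapping.keys f \<union> Poly_Mapping.keys g"
  have "finite A" "Poly_Mapping.keys f \<subseteq> A" "Poly_Mapping.keys g \<subseteq> A" "Poly_Mapping.keys (f + g) \<subseteq> A"
    using keys_add[of f g] by (auto simp: A_def)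
  then show ?thesis
    by (simp add: int_poly_eval_superset[of A] lookup_add distrib_right sum.distrib)
qed

lemma int_poly_eval_sum: "int_poly_eval \<phi> (\<Sum>x\<in>A. f x) = (\<Sum>x\<in>A. int_poly_eval \<phi> (f x))"
  by (induction A rule: infinite_finite_induct) (auto simp: int_poly_eval_add)

lemma poly_mapping_eq_sum_single:
  "f = (\<Sum>\<mu>\<in>Poly_Mapping.keys f. Poly_Mapping.single \<mu> (Poly_Mapping.lookup f \<mu>))"
proof (rule poly_mapping_eqI)
  fix \<nu>
  have "(\<Sum>\<mu>\<in>Poly_Mapping.keys f. Poly_Mapping.lookup (Poly_Mapping.single \<mu> (Poly_Mapping.lookup f \<mu>)) \<nu>) =
      (\<Sum>\<mu>\<in>Poly_Mapping.keys f. if \<mu> = \<nu> then Poly_Mapping.lookup f \<mu> else 0)"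
    by (intro sum.cong) (auto simp: lookup_single when_def)
  then show "Poly_Mapping.lookup f \<nu> = Poly_Mapping.lookup
      (\<Sum>\<mu>\<in>Poly_Mapping.keys f. Poly_Mapping.single \<mu> (Poly_Mapping.lookup f \<mu>)) \<nu>"
    by (simp add: lookup_sum in_keys_iff)
qed

text \<open>Valuation in the sense of assigning values: multiplicativity of \<open>\<phi>\<close>
  makes \<open>int_poly_eval \<phi>\<close> a ring homomorphism.\<close>

locale monomial_valuation =
  fixes \<phi> :: "('v \<Rightarrow>\<^sub>0 nat) \<Rightarrow> 'r::comm_ring_1"
  assumes \<phi>_0: "\<phi> 0 = 1" and \<phi>_add: "\<phi> (\<mu> + \<nu>) = \<phi> \<mu> * \<phi> \<nu>"
begin

lemma eval_1: "int_poly_eval \<phi> 1 = 1"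
  using int_poly_eval_single[of \<phi> 0 1] \<phi>_0 by simp

lemma eval_mult: "int_poly_eval \<phi> (f * g) = int_poly_eval \<phi> f * int_poly_eval \<phi> g"
proof -
  let ?s = "\<lambda>f \<mu>. Poly_Mapping.single \<mu> (Poly_Mapping.lookup f \<mu>)"
  have "f * g = (\<Sum>\<mu>\<in>Poly_Mapping.keys f. ?s f \<mu>) * (\<Sum>\<nu>\<in>Poly_Mapping.keys g. ?s g \<nu>)"
    by (simp flip: poly_mapping_eq_sum_single)
  then have "f * g = (\<Sum>\<mu>\<in>Poly_Mapping.keys f. \<Sum>\<nu>\<in>Poly_Mapping.keys g. ?s f \<mu> * ?s g \<nu>)"
    by (simp only: sum_product)
  then have "int_poly_eval \<phi> (f * g) = (\<Sum>\<mu>\<in>Poly_Mapping.keys f. \<Sum>\<nu>\<in>Poly_Mapping.keys g.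
      (of_int (Poly_Mapping.lookup f \<mu>) * \<phi> \<mu>) * (of_int (Poly_Mapping.lookup g \<nu>) * \<phi> \<nu>))"
    by (simp add: int_poly_eval_sum mult_single \<phi>_add mult_ac)
  then show ?thesis
    by (simp add: int_poly_eval_def sum_product)
qed

lemma eval_power: "int_poly_eval \<phi> (f ^ k) = int_poly_eval \<phi> f ^ k"
  by (induction k) (auto simp: eval_1 eval_mult)

lemma eval_of_nat: "int_poly_eval \<phi> (of_nat k) = of_nat k"
  by (induction k) (auto simp: eval_1 int_poly_eval_add)

lemmas eval_hom = int_poly_eval_sum int_poly_eval_add eval_mult eval_power eval_of_nat

end

section \<open>Congruences for p-th powers in commutative rings\<close>

lemma prime_dvd_power_add:
  fixes a b :: "'r::comm_ring_1"
  assumes "prime p"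
  shows "of_nat p dvd (a + b) ^ p - (a ^ p + b ^ p)"
proof -
  have p: "p > 0"
    using assms prime_gt_0_nat by blast
  have "(a + b) ^ p = (\<Sum>k\<le>p. of_nat (p choose k) * a ^ k * b ^ (p - k))"
    by (rule binomial_ring)
  also have "{..p} = insert 0 (insert p {0<..<p})"
    using p by auto
  also have "(\<Sum>k\<in>insert 0 (insert p {0<..<p}). of_nat (p choose k) * a ^ k * b ^ (p - k)) =
      b ^ p + (a ^ p + (\<Sum>k\<in>{0<..<p}. of_nat (p choose k) * a ^ k * b ^ (p - k)))"
    using p by simp
  finally have "(a + b) ^ p - (a ^ p + b ^ p) = (\<Sum>k\<in>{0<..<p}. of_nat (p choose k) * a ^ k * b ^ (p - k))"
    by simp
  moreover have "of_nat p dvd (of_nat (p choose k) :: 'r)" if "k \<in> {0<..<p}" for k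
  proof -
    have "p dvd (p choose k)"
      using that assms by (intro dvd_choose_prime) auto
    then obtain c where "p choose k = p * c"
      by (rule dvdE)
    then show ?thesis
      by simp
  qed
  ultimately show ?thesis
    by (simp only:) (intro dvd_sum dvd_mult2)
qed

lemma prime_dvd_power_sum:
  fixes a :: "'b \<Rightarrow> 'r::comm_ring_1"
  assumes "prime p"
  shows "of_nat p dvd (\<Sum>x\<in>A. a x) ^ p - (\<Sum>x\<in>A. a x ^ p)"
proof (induction A rule: infinite_finite_induct)
  case (insert y A)
  have "of_nat p dvd ((a y + (\<Sum>x\<in>A. a x)) ^ p - (a y ^ p + (\<Sum>x\<in>A. a x) ^ p)) +
      ((\<Sum>x\<in>A. a x) ^ p - (\<Sum>x\<in>A. a x ^ p))"
    by (intro dvd_add prime_dvd_power_add assms insert.IH)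
  then show ?case
    using insert.hyps by (simp add: algebra_simps)
qed (use assms prime_gt_0_nat in \<open>auto simp: power_0_left\<close>)

lemma int_fermat:
  assumes "prime p"
  shows "int p dvd c ^ p - c"
proof -
  define k where "k = nat (c mod int p)"
  have "int p > 0"
    using assms prime_gt_0_nat by simp
  then have k: "int k = c mod int p"
    by (simp add: k_def)
  \<comment> \<open>Applied to a sum of \<open>k\<close> ones.\<close>
  have "int p dvd int k ^ p - int k"
    using prime_dvd_power_sum[OF assms, of "\<lambda>_. 1 :: int" "{..<k}"] by simp
  then have "[int k ^ p = int k] (mod int p)"
    by (simp add: cong_iff_dvd_diff)
  moreover have "[c = int k] (mod int p)"
    by (simp add: k cong_def)
  ultimately have "[c ^ p = c] (mod int p)"
    by (meson cong_pow cong_sym cong_trans)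
  then show ?thesis
    by (simp add: cong_iff_dvd_diff)
qed

text \<open>Divisibility counterpart of \<open>av_power_p_diff\<close>, by the same factorization;
  it serves in the ring of integer polynomials.\<close>

lemma power_p_diff_dvd:
  fixes a b :: "'r::comm_ring_1"
  assumes "of_nat p ^ k dvd a - b" "k \<ge> 1"
  shows "of_nat p ^ Suc k dvd a ^ p - b ^ p"
proof -
  have "(\<Sum>i<p. b ^ (p - Suc i) * b ^ i) = (\<Sum>i<p. b ^ (p - 1))"
    by (intro sum.cong refl) (simp add: power_add[symmetric])
  then have "(\<Sum>i<p. b ^ (p - Suc i) * a ^ i) = (\<Sum>i<p. b ^ (p - Suc i) * (a ^ i - b ^ i)) + of_nat p * b ^ (p - 1)"
    by (simp add: right_diff_distrib sum_subtractf)
  moreover have "of_nat p dvd a - b"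
    using assms by (metis dvd_power_le dvd_refl dvd_trans power_one_right)
  then have "of_nat p dvd a ^ i - b ^ i" for i
    by (rule dvd_trans) (simp add: power_diff_sumr2)
  ultimately have "of_nat p dvd (\<Sum>i<p. b ^ (p - Suc i) * a ^ i)"
    by (simp only:) (intro dvd_add dvd_sum dvd_mult dvd_triv_left)
  then have "of_nat p ^ k * of_nat p dvd (a - b) * (\<Sum>i<p. b ^ (p - Suc i) * a ^ i)"
    using assms(1) by (rule mult_dvd_mono[rotated])
  then show ?thesis
    by (simp add: power_diff_sumr2 mult.commute)
qed

lemma power_p_power_diff_dvd:
  fixes a b :: "'r::comm_ring_1"
  assumes "of_nat p dvd a - b"
  shows "of_nat p ^ Suc k dvd a ^ (p ^ k) - b ^ (p ^ k)"
proof (induction k)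
  case (Suc k)
  have "of_nat p ^ Suc (Suc k) dvd (a ^ (p ^ k)) ^ p - (b ^ (p ^ k)) ^ p"
    by (intro power_p_diff_dvd Suc) auto
  then show ?case
    by (simp add: power_mult[symmetric] mult.commute)
qed (use assms in auto)

text \<open>The ring endomorphism that fixes the coefficients and raises each variable to its
  \<open>p\<close>-th power.\<close>

definition frobenius_lift :: "nat \<Rightarrow> (('v \<Rightarrow>\<^sub>0 nat) \<Rightarrow>\<^sub>0 int) \<Rightarrow> (('v \<Rightarrow>\<^sub>0 nat) \<Rightarrow>\<^sub>0 int)" where
  "frobenius_lift p = int_poly_eval (\<lambda>\<mu>. Poly_Mapping.single \<mu> 1 ^ p)"

lemma monomial_valuation_frobenius:
  "monomial_valuation (\<lambda>\<mu> :: 'v \<Rightarrow>\<^sub>0 nat. (Poly_Mapping.single \<mu> 1 :: ('v \<Rightarrow>\<^sub>0 nat) \<Rightarrow>\<^sub>0 int) ^ p)"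
  by unfold_locales (simp_all add: mult_single power_mult_distrib[symmetric])

text \<open>Modulo \<open>p\<close> the \<open>p\<close>-th power of a sum is the sum of the
  \<open>p\<close>-th powers, and Fermat's theorem removes the power from the coefficients.\<close>

lemma frobenius_lift_cong:
  assumes "prime p"
  shows "of_nat p dvd frobenius_lift p f - f ^ p"
proof -
  let ?s = "\<lambda>\<mu>. Poly_Mapping.single \<mu> (1::int)"
  let ?c = "\<lambda>\<mu>. of_int (Poly_Mapping.lookup f \<mu>) :: ('a \<Rightarrow>\<^sub>0 nat) \<Rightarrow>\<^sub>0 int"
  have f: "f = (\<Sum>\<mu>\<in>Poly_Mapping.keys f. ?c \<mu> * ?s \<mu>)"
  proof -
    have "?c \<mu> * ?s \<mu> = Poly_Mapping.single \<mu> (Poly_Mapping.lookup f \<mu>)" for \<mu>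
      by (simp add: single_of_int[symmetric] mult_single del: single_of_int)
    then show ?thesis
      using poly_mapping_eq_sum_single[of f] by simp
  qed
  have "f ^ p = (\<Sum>\<mu>\<in>Poly_Mapping.keys f. ?c \<mu> * ?s \<mu>) ^ p"
    using f by simp
  then have "of_nat p dvd f ^ p - (\<Sum>\<mu>\<in>Poly_Mapping.keys f. (?c \<mu> * ?s \<mu>) ^ p)"
    using prime_dvd_power_sum[OF assms, of "\<lambda>\<mu>. ?c \<mu> * ?s \<mu>" "Poly_Mapping.keys f"] by simp
  moreover have "of_nat p dvd (\<Sum>\<mu>\<in>Poly_Mapping.keys f. (?c \<mu> * ?s \<mu>) ^ p - ?c \<mu> * ?s \<mu> ^ p)"
  proof (rule dvd_sum)
    fix \<mu>
    obtain b where "Poly_Mapping.lookup f \<mu> ^ p - Poly_Mapping.lookup f \<mu> = int p * b"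
      using int_fermat[OF assms] by blast
    then have "of_int (Poly_Mapping.lookup f \<mu> ^ p - Poly_Mapping.lookup f \<mu>) =
        (of_int (int p * b) :: ('a \<Rightarrow>\<^sub>0 nat) \<Rightarrow>\<^sub>0 int)"
      by (rule arg_cong)
    then have "?c \<mu> ^ p - ?c \<mu> = of_nat p * of_int b"
      by simp
    moreover have "(?c \<mu> * ?s \<mu>) ^ p - ?c \<mu> * ?s \<mu> ^ p = (?c \<mu> ^ p - ?c \<mu>) * ?s \<mu> ^ p"
      by (simp add: power_mult_distrib algebra_simps)
    ultimately show "of_nat p dvd (?c \<mu> * ?s \<mu>) ^ p - ?c \<mu> * ?s \<mu> ^ p"
      by simp
  qed
  ultimately have "of_nat p dvd - ((f ^ p - (\<Sum>\<mu>\<in>Poly_Mapping.keys f. (?c \<mu> * ?s \<mu>) ^ p)) +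
      (\<Sum>\<mu>\<in>Poly_Mapping.keys f. (?c \<mu> * ?s \<mu>) ^ p - ?c \<mu> * ?s \<mu> ^ p))"
    by (intro dvd_minus_iff[THEN iffD2] dvd_add)
  then show ?thesis
    by (simp add: frobenius_lift_def int_poly_eval_def sum_subtractf algebra_simps)
qed

text \<open>The variable \<open>l\<close> stands for a Witt vector whose only nonzero component is
  at position \<open>i l\<close>.\<close>

locale witt_variables =
  fixes p :: nat and L :: "'v set" and i :: "'v \<Rightarrow> nat"
  assumes prime_p: "prime p" and finite_L: "finite L"
begin

text \<open>The weight \<open>p ^ i l\<close> of the variable \<open>l\<close> is chosen so that
  every term of \<open>ghost r\<close> has weight \<open>p ^ r\<close>.\<close>

definition weight :: "('v \<Rightarrow>\<^sub>0 nat) \<Rightarrow> nat" where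
  "weight \<mu> = (\<Sum>l\<in>L. Poly_Mapping.lookup \<mu> l * p ^ i l)"

definition weight_le :: "nat \<Rightarrow> (('v \<Rightarrow>\<^sub>0 nat) \<Rightarrow>\<^sub>0 int) \<Rightarrow> bool" where
  "weight_le D f \<longleftrightarrow> (\<forall>\<mu>\<in>Poly_Mapping.keys f. weight \<mu> \<le> D)"

lemma weight_add: "weight (\<mu> + \<nu>) = weight \<mu> + weight \<nu>"
  by (simp add: weight_def lookup_add distrib_right sum.distrib)

lemma weight_le_sum: "(\<And>x. x \<in> A \<Longrightarrow> weight_le D (f x)) \<Longrightarrow> weight_le D (\<Sum>x\<in>A. f x)"
  unfolding weight_le_def using keys_sum[of f A] by blast

lemma weight_le_diff: "weight_le D f \<Longrightarrow> weight_le D g \<Longrightarrow> weight_le D (f - g)"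
  unfolding weight_le_def using keys_diff[of f g] by blast

lemma weight_le_mult: "weight_le D f \<Longrightarrow> weight_le E g \<Longrightarrow> weight_le (D + E) (f * g)"
  unfolding weight_le_def using keys_mult[of f g] by (force simp: weight_add intro: add_mono)

lemma weight_le_1: "weight_le D 1"
  by (simp add: weight_le_def weight_def)

lemma weight_le_power: "weight_le D f \<Longrightarrow> weight_le (k * D) (f ^ k)"
  by (induction k) (auto simp: weight_le_1 intro: weight_le_mult)

lemma weight_le_of_nat_power: "weight_le 0 (of_nat k ^ j)"
proof -
  have "weight_le 0 (of_nat k)"
    by (simp add: weight_le_def weight_def flip: single_of_nat)
  from weight_le_power[OF this, of j] show ?thesis
    by simp
qed

text \<open>Integer coefficients have no torsion, so multiplication by \<open>p ^ k\<close> keeps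
  the set of monomials.\<close>

lemma weight_le_cancel:
  assumes "weight_le D (of_nat p ^ k * f)"
  shows "weight_le D f"
proof -
  have "Poly_Mapping.lookup (of_nat p ^ k * f) \<mu> = int p ^ k * Poly_Mapping.lookup f \<mu>" for \<mu>
  proof -
    have "of_nat p ^ k * f = Poly_Mapping.map ((*) (int p ^ k)) f"
      by (simp add: mult_map_scale_conv_mult flip: of_nat_power)
    then show ?thesis
      by (simp add: map.rep_eq when_def)
  qed
  then have "Poly_Mapping.keys f = Poly_Mapping.keys (of_nat p ^ k * f)"
    using prime_p by (auto simp: in_keys_iff)
  then show ?thesis
    using assms by (simp add: weight_le_def)
qed

definition var :: "'v \<Rightarrow> ('v \<Rightarrow>\<^sub>0 nat) \<Rightarrow>\<^sub>0 int" where
  "var l = Poly_Mapping.single (Poly_Mapping.single l 1) 1"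

text \<open>The \<open>r\<close>-th ghost component of the sum of the Witt vectors belonging to the
  variables in \<open>L\<close>; those with \<open>i l > r\<close> contribute 0 to it.\<close>

definition ghost :: "nat \<Rightarrow> ('v \<Rightarrow>\<^sub>0 nat) \<Rightarrow>\<^sub>0 int" where
  "ghost r = (\<Sum>l\<in>{l \<in> L. i l \<le> r}. of_nat p ^ i l * var l ^ (p ^ (r - i l)))"

lemma weight_le_var: "l \<in> L \<Longrightarrow> weight_le (p ^ i l) (var l)"
proof -
  assume "l \<in> L"
  then have "weight (Poly_Mapping.single l 1) = p ^ i l"
    using finite_L sum.remove[of L l "\<lambda>l'. Poly_Mapping.lookup (Poly_Mapping.single l 1) l' * p ^ i l'"]
    by (simp add: weight_def lookup_single when_def)
  then show ?thesis
    by (simp add: weight_le_def var_def)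
qed

lemma weight_le_ghost: "weight_le (p ^ r) (ghost r)"
  unfolding ghost_def
proof (rule weight_le_sum)
  fix l assume l: "l \<in> {l \<in> L. i l \<le> r}"
  have "weight_le (0 + p ^ (r - i l) * p ^ i l) (of_nat p ^ i l * var l ^ (p ^ (r - i l)))"
    using l by (intro weight_le_mult weight_le_of_nat_power weight_le_power weight_le_var) auto
  then show "weight_le (p ^ r) (of_nat p ^ i l * var l ^ (p ^ (r - i l)))"
    using l by (simp add: power_add[symmetric])
qed

text \<open>Raising the variables of \<open>ghost r\<close> to the \<open>p\<close>-th power gives
  exactly the terms of \<open>ghost (Suc r)\<close> with \<open>i l \<le> r\<close>; the remaining
  ones carry the factor \<open>p ^ Suc r\<close>.\<close>

lemma frobenius_lift_ghost: "of_nat p ^ Suc r dvd ghost (Suc r) - frobenius_lift p (ghost r)"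
proof -
  interpret fr: monomial_valuation "\<lambda>\<mu> :: 'v \<Rightarrow>\<^sub>0 nat. (Poly_Mapping.single \<mu> 1 :: ('v \<Rightarrow>\<^sub>0 nat) \<Rightarrow>\<^sub>0 int) ^ p"
    by (rule monomial_valuation_frobenius)
  have "frobenius_lift p (var l) = var l ^ p" for l
    by (simp add: frobenius_lift_def var_def)
  then have "frobenius_lift p (ghost r) =
      (\<Sum>l\<in>{l \<in> L. i l \<le> r}. of_nat p ^ i l * (var l ^ p) ^ (p ^ (r - i l)))"
    by (simp add: frobenius_lift_def ghost_def fr.eval_hom)
  also have "\<dots> = (\<Sum>l\<in>{l \<in> L. i l \<le> r}. of_nat p ^ i l * var l ^ (p ^ (Suc r - i l)))"
    by (intro sum.cong refl) (simp add: power_mult[symmetric] Suc_diff_le)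
  finally have *: "frobenius_lift p (ghost r) =
      (\<Sum>l\<in>{l \<in> L. i l \<le> r}. of_nat p ^ i l * var l ^ (p ^ (Suc r - i l)))" .
  have "ghost (Suc r) - frobenius_lift p (ghost r) =
      (\<Sum>l\<in>{l \<in> L. i l \<le> Suc r} - {l \<in> L. i l \<le> r}. of_nat p ^ i l * var l ^ (p ^ (Suc r - i l)))"
    unfolding * unfolding ghost_def using finite_L by (subst sum_diff) auto
  also have "of_nat p ^ Suc r dvd \<dots>"
    by (intro dvd_sum dvd_mult2) (auto simp: not_le le_Suc_eq)
  finally show ?thesis .
qed

text \<open>Dwork's criterion: \<open>frobenius_lift p f\<close> is congruent to \<open>f ^ p\<close> modulo \<open>p\<close>, which makes
  the difference of the two sides divisible by \<open>p ^ r\<close> before the \<open>r\<close>-th Witt component is split off.\<close>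

lemma witt_components:
  obtains s where "\<And>r. r \<le> N \<Longrightarrow> ghost r = (\<Sum>e\<le>r. of_nat p ^ e * s e ^ (p ^ (r - e)))"
    "\<And>e. e \<le> N \<Longrightarrow> weight_le (p ^ e) (s e)"
proof -
  have "\<exists>s. \<forall>r\<le>N. ghost r = (\<Sum>e\<le>r. of_nat p ^ e * s e ^ (p ^ (r - e))) \<and> weight_le (p ^ r) (s r)"
  proof (induction N)
    case 0
    show ?case
      using weight_le_ghost[of 0] by (intro exI[of _ "\<lambda>_. ghost 0"]) simp
  next
    case (Suc N)
    then obtain s where s: "\<And>r. r \<le> N \<Longrightarrow> ghost r = (\<Sum>e\<le>r. of_nat p ^ e * s e ^ (p ^ (r - e)))"
      "\<And>r. r \<le> N \<Longrightarrow> weight_le (p ^ r) (s r)"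
      by blast
    interpret fr: monomial_valuation "\<lambda>\<mu> :: 'v \<Rightarrow>\<^sub>0 nat. (Poly_Mapping.single \<mu> 1 :: ('v \<Rightarrow>\<^sub>0 nat) \<Rightarrow>\<^sub>0 int) ^ p"
      by (rule monomial_valuation_frobenius)
    \<comment> \<open>What the components found so far contribute to
      \<open>ghost (Suc N)\<close>.\<close>
    define R where "R = (\<Sum>e\<le>N. of_nat p ^ e * s e ^ (p ^ (Suc N - e)))"
    have "frobenius_lift p (ghost N) = (\<Sum>e\<le>N. of_nat p ^ e * frobenius_lift p (s e) ^ (p ^ (N - e)))"
      unfolding s(1)[OF order_refl] by (simp add: frobenius_lift_def fr.eval_hom)
    moreover have "R = (\<Sum>e\<le>N. of_nat p ^ e * (s e ^ p) ^ (p ^ (N - e)))"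
      unfolding R_def by (intro sum.cong refl) (simp add: power_mult[symmetric] Suc_diff_le)
    ultimately have "frobenius_lift p (ghost N) - R =
        (\<Sum>e\<le>N. of_nat p ^ e * (frobenius_lift p (s e) ^ (p ^ (N - e)) - (s e ^ p) ^ (p ^ (N - e))))"
      by (simp add: sum_subtractf right_diff_distrib)
    also have "of_nat p ^ Suc N dvd \<dots>"
    proof (rule dvd_sum)
      fix e assume "e \<in> {..N}"
      then have "Suc N = e + Suc (N - e)"
        by simp
      then have "of_nat p ^ Suc N = (of_nat p ^ e * of_nat p ^ Suc (N - e) :: ('v \<Rightarrow>\<^sub>0 nat) \<Rightarrow>\<^sub>0 int)"
        by (metis power_add)
      also have "\<dots> dvd of_nat p ^ e * (frobenius_lift p (s e) ^ (p ^ (N - e)) - (s e ^ p) ^ (p ^ (N - e)))"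
        by (intro mult_dvd_mono dvd_refl power_p_power_diff_dvd frobenius_lift_cong prime_p)
      finally show "of_nat p ^ Suc N dvd
          of_nat p ^ e * (frobenius_lift p (s e) ^ (p ^ (N - e)) - (s e ^ p) ^ (p ^ (N - e)))" .
    qed
    finally have "of_nat p ^ Suc N dvd (ghost (Suc N) - frobenius_lift p (ghost N)) + (frobenius_lift p (ghost N) - R)"
      by (intro dvd_add frobenius_lift_ghost)
    \<comment> \<open>\<open>t\<close> becomes the component at \<open>Suc N\<close>. Division by
      \<open>p ^ Suc N\<close> leaves the monomials unchanged, so the weight bound passes to
      \<open>t\<close>.\<close>
    then obtain t where t: "ghost (Suc N) - R = of_nat p ^ Suc N * t"
      by (auto simp: dvd_def)
    have "weight_le (p ^ Suc N) (ghost (Suc N) - R)"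
    proof (rule weight_le_diff[OF weight_le_ghost])
      show "weight_le (p ^ Suc N) R"
        unfolding R_def
      proof (rule weight_le_sum)
        fix e assume e: "e \<in> {..N}"
        have "weight_le (0 + p ^ (Suc N - e) * p ^ e) (of_nat p ^ e * s e ^ (p ^ (Suc N - e)))"
          using e s(2) by (intro weight_le_mult weight_le_of_nat_power weight_le_power) auto
        then show "weight_le (p ^ Suc N) (of_nat p ^ e * s e ^ (p ^ (Suc N - e)))"
          using e by (simp add: power_add[symmetric] del: power_Suc)
      qed
    qed
    then have wt: "weight_le (p ^ Suc N) t"
      unfolding t by (rule weight_le_cancel)
    define s' where "s' = s(Suc N := t)"
    have "ghost r = (\<Sum>e\<le>r. of_nat p ^ e * s' e ^ (p ^ (r - e))) \<and> weight_le (p ^ r) (s' r)" if "r \<le> Suc N" for r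
    proof (cases "r = Suc N")
      case True
      have "(\<Sum>e\<le>N. of_nat p ^ e * s' e ^ (p ^ (Suc N - e))) = R"
        unfolding R_def by (intro sum.cong) (auto simp: s'_def)
      then show ?thesis
        using t wt True by (simp add: s'_def algebra_simps)
    next
      case False
      then have r: "r \<le> N"
        using that by simp
      have "(\<Sum>e\<le>r. of_nat p ^ e * s' e ^ (p ^ (r - e))) = (\<Sum>e\<le>r. of_nat p ^ e * s e ^ (p ^ (r - e)))"
        using r by (intro sum.cong) (auto simp: s'_def)
      then show ?thesis
        using s r False by (simp add: s'_def)
    qed
    then show ?case
      by blast
  qed
  then show ?thesis
    using that by blast
qed

end

context unramified_padic_extension
begin

text \<open>A summand whose \<open>S e\<close> is a nonunit is divisible by
  \<open>p ^ Suc N\<close>, and the summand at \<open>e\<close> always by \<open>p ^ e\<close>. If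
  the sum vanishes modulo \<open>p ^ m\<close>, induction on \<open>e\<close> therefore isolates
  \<open>p ^ e * S e ^ (p ^ (N - e))\<close> modulo \<open>p ^ Suc e\<close>, which makes
  \<open>S e\<close> a nonunit.\<close>

lemma witt_vanishing_iff:
  fixes S :: "nat \<Rightarrow> 'a"
  assumes S: "\<And>e. e \<le> N \<Longrightarrow> av (S e) \<le> 1" and "m \<le> Suc N"
  shows "av (\<Sum>e\<le>N. of_nat p ^ e * S e ^ (p ^ (N - e))) \<le> 1 / real p ^ m \<longleftrightarrow>
    (\<forall>e<m. av (S e) \<le> 1 / real p)"
proof -
  define T where "T e = of_nat p ^ e * S e ^ (p ^ (N - e))" for e
  have avT: "av (T e) = 1 / real p ^ e * av (S e) ^ (p ^ (N - e))" for e
    by (simp add: T_def av_mult av_of_nat_p_power av_power[of "S e"])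
  have high: "av (T e) \<le> 1 / real p ^ e" if "e \<le> N" for e
    using av_mult_le[of "of_nat p ^ e" "1 / real p ^ e" "S e ^ (p ^ (N - e))" 1]
      av_power_le_1[OF S[OF that]] by (simp add: T_def av_of_nat_p_power)
  have small: "av (T e) \<le> 1 / real p ^ Suc N" if "e \<le> N" "av (S e) \<le> 1 / real p" for e
  proof -
    have "av (T e) \<le> 1 / real p ^ e * (1 / real p) ^ (p ^ (N - e))"
      unfolding avT using that av_nonneg by (intro mult_left_mono power_mono) auto
    also have "\<dots> = 1 / real p ^ (e + p ^ (N - e))"
      by (simp add: power_divide power_add)
    \<comment> \<open>The power \<open>p ^ (N - e)\<close> supplies at least
      \<open>N - e + 1\<close> further factors \<open>p\<close>.\<close>
    also have "\<dots> \<le> 1 / real p ^ Suc N"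
    proof (rule inverse_p_power_mono)
      have "N - e < 2 ^ (N - e)"
        by (rule less_exp)
      also have "\<dots> \<le> p ^ (N - e)"
        using p_ge_2 by (intro power_mono) auto
      finally show "Suc N \<le> e + p ^ (N - e)"
        using that by linarith
    qed
    finally show ?thesis .
  qed
  have le: "1 / real p ^ Suc N \<le> 1 / real p ^ m"
    using assms(2) by (rule inverse_p_power_mono)
  have "av (\<Sum>e\<le>N. T e) \<le> 1 / real p ^ m \<longleftrightarrow> (\<forall>e<m. av (S e) \<le> 1 / real p)"
  proof
    assume z: "av (\<Sum>e\<le>N. T e) \<le> 1 / real p ^ m"
    show "\<forall>e<m. av (S e) \<le> 1 / real p"
    proof (intro allI impI)
      fix e assume "e < m"
      then show "av (S e) \<le> 1 / real p"
      proof (induction e rule: less_induct)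
        case (less e)
        then have e: "e \<le> N"
          using assms(2) by simp
        have "(\<Sum>e\<le>N. T e) = T e + (\<Sum>e'\<in>{..N} - {e}. T e')"
          using e by (intro sum.remove) auto
        then have "T e = (\<Sum>e\<le>N. T e) - (\<Sum>e'\<in>{..N} - {e}. T e')"
          by simp
        also have "av \<dots> \<le> 1 / real p ^ Suc e"
        proof (rule av_diff_le)
          show "av (\<Sum>e\<le>N. T e) \<le> 1 / real p ^ Suc e"
            using z inverse_p_power_mono[of "Suc e" m] less.prems by linarith
          show "av (\<Sum>e'\<in>{..N} - {e}. T e') \<le> 1 / real p ^ Suc e"
          proof (rule av_sum_le)
            fix e' assume e': "e' \<in> {..N} - {e}"
            show "av (T e') \<le> 1 / real p ^ Suc e"
            proof (cases "e' < e")
              case True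
              then have "av (T e') \<le> 1 / real p ^ Suc N"
                using less e' by (intro small) auto
              also have "\<dots> \<le> 1 / real p ^ Suc e"
                using e by (intro inverse_p_power_mono) simp
              finally show ?thesis .
            next
              case False
              then show ?thesis
                using high[of e'] e' inverse_p_power_mono[of "Suc e" e'] by simp
            qed
          qed simp
        qed
        finally have "av (S e) ^ (p ^ (N - e)) \<le> 1 / real p"
          unfolding avT using p_ge_2 by (simp add: field_simps)
        then have "av (S e) ^ (p ^ (N - e)) < 1"
          using inverse_p_less_1 by linarith
        then have "av (S e) < 1"
          using one_le_power[of "av (S e)" "p ^ (N - e)"] by (meson not_le)
        then show ?case
          by (rule av_less_1_imp_le)
      qed
    qed
  next
    assume S0: "\<forall>e<m. av (S e) \<le> 1 / real p"
    show "av (\<Sum>e\<le>N. T e) \<le> 1 / real p ^ m"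
    proof (rule av_sum_le)
      fix e assume e: "e \<in> {..N}"
      show "av (T e) \<le> 1 / real p ^ m"
      proof (cases "e < m")
        case True
        then show ?thesis
          using small[of e] S0 e le by simp
      next
        case False
        then show ?thesis
          using high[of e] e inverse_p_power_mono[of m e] by simp
      qed
    qed simp
  qed
  then show ?thesis
    by (simp add: T_def)
qed

end

section \<open>The theorem of Ax and Katz\<close>

context unramified_padic_extension
begin

text \<open>The sum factors into one power sum per variable. Each is 0, \<open>q - 1\<close> or, for
  exponent 0, \<open>q\<close>; only the last contributes factors \<open>p\<close>.\<close>

lemma av_sum_teich_monomial_le:
  fixes U :: "nat \<Rightarrow> nat"
  shows "av (\<Sum>X\<in>{1..n} \<rightarrow>\<^sub>E teich (p ^ h). \<Prod>j\<in>{1..n}. X j ^ U j) \<le>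
    (if \<forall>j\<in>{1..n}. (p ^ h - 1) dvd U j then 1 / real p ^ (h * card {j \<in> {1..n}. U j = 0}) else 0)"
proof -
  define s where "s u = (\<Sum>t\<in>teich (p ^ h). t ^ u :: 'a)" for u
  have prod: "(\<Sum>X\<in>{1..n} \<rightarrow>\<^sub>E teich (p ^ h). \<Prod>j\<in>{1..n}. X j ^ U j) = (\<Prod>j\<in>{1..n}. s (U j))"
    unfolding s_def by (rule prod_sum_PiE[symmetric]) (auto simp: finite_teich)
  show ?thesis
  proof (cases "\<forall>j\<in>{1..n}. (p ^ h - 1) dvd U j")
    case True
    have "av (s u) \<le> (if u = 0 then 1 / real p ^ h else 1)" for u
      unfolding s_def sum_teich_power
      using av_of_nat_le_1 av_of_nat_p_power[of h] by (auto simp del: of_nat_diff)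
    then have "(\<Prod>j\<in>{1..n}. av (s (U j))) \<le> (\<Prod>j\<in>{1..n}. if U j = 0 then 1 / real p ^ h else 1)"
      by (intro prod_mono) (auto simp: av_nonneg)
    also have "\<dots> = 1 / real p ^ (h * card {j \<in> {1..n}. U j = 0})"
      by (simp add: prod.If_cases Int_def power_mult power_divide)
    finally show ?thesis
      using True unfolding prod av_prod by simp
  next
    case False
    then obtain j where j: "j \<in> {1..n}" "\<not> (p ^ h - 1) dvd U j"
      by blast
    then have "U j \<noteq> 0"
      by (intro notI) simp
    then have "s (U j) = 0"
      using j(2) by (simp add: s_def sum_teich_power)
    then have zero: "(\<Prod>j\<in>{1..n}. s (U j)) = 0"
      using j(1) by (intro prod_zero) auto
    show ?thesis
      using False unfolding prod zero by simp
  qed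
qed

lemma av_multinom_le: "av (of_nat (multinom A k)) \<le> 1 / real p ^ multiplicity p (multinom A k)"
  by (rule av_of_nat_multiplicity_le) (rule multiplicity_dvd)

text \<open>Expanding every power by the multinomial theorem gives a sum over \<open>g\<close>, a
  choice of exponents for each condition. The factors \<open>p\<close> of the coefficient
  \<open>C g\<close> and of the sum of the monomial with exponents \<open>U g\<close> are what
  \<open>katz_exponent_bound\<close> adds up.\<close>

lemma av_sum_prod_power_le:
  fixes A :: "'c \<Rightarrow> 'b set" and c :: "'c \<Rightarrow> 'b \<Rightarrow> 'a" and w :: "'c \<Rightarrow> 'b \<Rightarrow> nat \<Rightarrow> nat"
  assumes S: "finite S" and A: "\<And>i. i \<in> S \<Longrightarrow> finite (A i)"
    and c: "\<And>i x. i \<in> S \<Longrightarrow> x \<in> A i \<Longrightarrow> av (c i x) \<le> 1"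
    and w: "\<And>i x. i \<in> S \<Longrightarrow> x \<in> A i \<Longrightarrow> (\<Sum>j\<in>{1..n}. w i x j) \<le> D i"
    and D: "\<And>i. i \<in> S \<Longrightarrow> D i \<le> \<Delta>" "\<Delta> \<ge> 1"
    and t: "\<Delta> * t + (\<Sum>i\<in>S. D i) < n"
  shows "av (\<Sum>X\<in>{1..n} \<rightarrow>\<^sub>E teich (p ^ h). \<Prod>i\<in>S.
      (\<Sum>x\<in>A i. c i x * (\<Prod>j\<in>{1..n}. X j ^ w i x j)) ^ ((p ^ h - 1) * p ^ M)) \<le> 1 / real p ^ (h * (t + 1))"
proof -
  define Q where "Q = (p ^ h - 1) * p ^ M"
  define J where "J = PiE S (\<lambda>i. compositions (A i) Q)"
  define C where "C g = (\<Prod>i\<in>S. of_nat (multinom (A i) (g i)) * (\<Prod>x\<in>A i. c i x ^ g i x))" for g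
  define U where "U g j = (\<Sum>i\<in>S. \<Sum>x\<in>A i. g i x * w i x j)" for g :: "'c \<Rightarrow> 'b \<Rightarrow> nat" and j
  have expand: "(\<Prod>i\<in>S. (\<Sum>x\<in>A i. c i x * (\<Prod>j\<in>{1..n}. X j ^ w i x j)) ^ Q) =
      (\<Sum>g\<in>J. C g * (\<Prod>j\<in>{1..n}. X j ^ U g j))" for X
  proof -
    have "(\<Prod>i\<in>S. (\<Sum>x\<in>A i. c i x * (\<Prod>j\<in>{1..n}. X j ^ w i x j)) ^ Q) =
        (\<Prod>i\<in>S. \<Sum>k\<in>compositions (A i) Q. of_nat (multinom (A i) k) *
          (\<Prod>x\<in>A i. (c i x * (\<Prod>j\<in>{1..n}. X j ^ w i x j)) ^ k x))"
      using A by (intro prod.cong refl multinomial_theorem)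
    also have "\<dots> = (\<Sum>g\<in>J. \<Prod>i\<in>S. of_nat (multinom (A i) (g i)) *
          (\<Prod>x\<in>A i. (c i x * (\<Prod>j\<in>{1..n}. X j ^ w i x j)) ^ g i x))"
      unfolding J_def using S A by (intro prod_sum_PiE) (auto simp: finite_compositions)
    also have "\<dots> = (\<Sum>g\<in>J. C g * (\<Prod>j\<in>{1..n}. X j ^ U g j))"
    proof (intro sum.cong refl)
      fix g
      have "(\<Prod>i\<in>S. \<Prod>x\<in>A i. (\<Prod>j\<in>{1..n}. X j ^ w i x j) ^ g i x) =
          (\<Prod>i\<in>S. \<Prod>x\<in>A i. \<Prod>j\<in>{1..n}. X j ^ (g i x * w i x j))"
        by (simp add: prod_power_distrib power_mult[symmetric] mult.commute)
      also have "\<dots> = (\<Prod>i\<in>S. \<Prod>j\<in>{1..n}. \<Prod>x\<in>A i. X j ^ (g i x * w i x j))"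
        by (intro prod.cong refl, rule prod.swap)
      also have "\<dots> = (\<Prod>j\<in>{1..n}. \<Prod>i\<in>S. \<Prod>x\<in>A i. X j ^ (g i x * w i x j))"
        by (rule prod.swap)
      also have "\<dots> = (\<Prod>j\<in>{1..n}. X j ^ U g j)"
        by (simp add: U_def power_sum)
      finally show "(\<Prod>i\<in>S. of_nat (multinom (A i) (g i)) *
            (\<Prod>x\<in>A i. (c i x * (\<Prod>j\<in>{1..n}. X j ^ w i x j)) ^ g i x)) = C g * (\<Prod>j\<in>{1..n}. X j ^ U g j)"
        by (simp add: C_def power_mult_distrib prod.distrib mult.assoc)
    qed
    finally show ?thesis .
  qed
  have summand: "av (C g * (\<Sum>X\<in>{1..n} \<rightarrow>\<^sub>E teich (p ^ h). \<Prod>j\<in>{1..n}. X j ^ U g j)) \<le> 1 / real p ^ (h * (t + 1))"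
    if g: "g \<in> J" for g
  proof (cases "\<forall>j\<in>{1..n}. (p ^ h - 1) dvd U g j")
    case True
    define v where "v i = multiplicity p (multinom (A i) (g i))" for i
    have gi: "sum (g i) (A i) = Q" if "i \<in> S" for i
      using g that by (auto simp: J_def compositions_def PiE_iff)
    have "av (C g) \<le> (\<Prod>i\<in>S. 1 / real p ^ v i)"
      unfolding C_def av_prod
    proof (intro prod_mono conjI av_nonneg)
      fix i assume i: "i \<in> S"
      have "av ((\<Prod>x\<in>A i. c i x ^ g i x) * of_nat (multinom (A i) (g i))) \<le> 1 / real p ^ v i"
        unfolding v_def using i A c
        by (intro av_mult_le_left av_prod_le_1 av_power_le_1 av_multinom_le) auto
      then show "av (of_nat (multinom (A i) (g i)) * (\<Prod>x\<in>A i. c i x ^ g i x)) \<le> 1 / real p ^ v i"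
        by (simp add: mult.commute)
    qed
    also have "\<dots> = 1 / real p ^ (\<Sum>i\<in>S. v i)"
      by (simp add: prod_dividef power_sum)
    finally have "av (C g * (\<Sum>X\<in>{1..n} \<rightarrow>\<^sub>E teich (p ^ h). \<Prod>j\<in>{1..n}. X j ^ U g j)) \<le>
        1 / real p ^ (\<Sum>i\<in>S. v i) * (1 / real p ^ (h * card {j \<in> {1..n}. U g j = 0}))"
      using av_sum_teich_monomial_le[of "U g" n] True by (intro av_mult_le) auto
    also have "\<dots> = 1 / real p ^ ((\<Sum>i\<in>S. v i) + h * card {j \<in> {1..n}. U g j = 0})"
      by (simp add: power_add)
    also have "\<dots> \<le> 1 / real p ^ (h * (t + 1))"
    proof (rule inverse_p_power_mono)
      \<comment> \<open>In base \<open>p\<close> the exponent \<open>(p ^ h - 1) * p ^ M\<close>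
        consists of \<open>h\<close> digits \<open>p - 1\<close> followed by zeros, so its digit sum
        is independent of \<open>M\<close>: the precision of the indicator can be raised without any
        loss in valuation.\<close>
      have "(p - 1) * v i + h * (p - 1) = (\<Sum>x\<in>A i. digit_sum p (g i x))" if "i \<in> S" for i
        using multiplicity_multinom[OF prime_p A[OF that], of "g i"] gi[OF that]
          digit_sum_mult_power[OF p_ge_2, of M "p ^ h - 1"] digit_sum_power_minus_1[OF p_ge_2, of h]
        by (simp add: v_def Q_def mult.commute)
      then show "h * (t + 1) \<le> (\<Sum>i\<in>S. v i) + h * card {j \<in> {1..n}. U g j = 0}"
        unfolding U_def using S A w D t gi True p_ge_2 h_pos
        by (intro katz_exponent_bound[where M = M and D = D and \<Delta> = \<Delta> and p = p])
          (auto simp: Q_def U_def)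
    qed
    finally show ?thesis .
  next
    case False
    then have "av (\<Sum>X\<in>{1..n} \<rightarrow>\<^sub>E teich (p ^ h). \<Prod>j\<in>{1..n}. X j ^ U g j) \<le> 0"
      using av_sum_teich_monomial_le[of "U g" n] by (simp only: if_False)
    then have "av (C g * (\<Sum>X\<in>{1..n} \<rightarrow>\<^sub>E teich (p ^ h). \<Prod>j\<in>{1..n}. X j ^ U g j)) = 0"
      using av_nonneg[of "\<Sum>X\<in>{1..n} \<rightarrow>\<^sub>E teich (p ^ h). \<Prod>j\<in>{1..n}. X j ^ U g j"] by (simp add: av_mult)
    then show ?thesis
      by simp
  qed
  have "(\<Sum>X\<in>{1..n} \<rightarrow>\<^sub>E teich (p ^ h). \<Prod>i\<in>S. (\<Sum>x\<in>A i. c i x * (\<Prod>j\<in>{1..n}. X j ^ w i x j)) ^ Q) =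
      (\<Sum>g\<in>J. C g * (\<Sum>X\<in>{1..n} \<rightarrow>\<^sub>E teich (p ^ h). \<Prod>j\<in>{1..n}. X j ^ U g j))"
    unfolding expand sum_distrib_left by (rule sum.swap)
  also have "av \<dots> \<le> 1 / real p ^ (h * (t + 1))"
    using summand by (intro av_sum_le) auto
  finally show ?thesis
    by (simp only: Q_def)
qed

lemma power_indicator_close:
  assumes "av z \<le> 1" "k \<le> Suc M"
  shows "av ((1 - z ^ ((p ^ h - 1) * p ^ M)) - of_bool (av z \<le> 1 / real p)) \<le> 1 / real p ^ k"
proof (cases "av z \<le> 1 / real p")
  case True
  have "1 * p ^ M \<le> (p ^ h - 1) * p ^ M"
    using q_ge_2 by (intro mult_right_mono) auto
  moreover have "M < p ^ M"
    using p_ge_2 by (intro less_le_trans[OF less_exp] power_mono) auto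
  ultimately have k: "k \<le> (p ^ h - 1) * p ^ M"
    using assms(2) by linarith
  have "av (z ^ ((p ^ h - 1) * p ^ M)) \<le> (1 / real p) ^ ((p ^ h - 1) * p ^ M)"
    unfolding av_power using True av_nonneg by (intro power_mono) auto
  also have "\<dots> \<le> 1 / real p ^ k"
    using inverse_p_power_mono[OF k] by (simp add: power_divide)
  finally show ?thesis
    using True by simp
next
  case False
  then have "av z = 1"
    using assms(1) av_less_1_imp_le[of z] by linarith
  then have "av (z ^ ((p ^ h - 1) * p ^ M) - 1) \<le> 1 / real p ^ Suc M"
    by (rule unit_power_close_to_1)
  then have "av (1 - z ^ ((p ^ h - 1) * p ^ M)) \<le> 1 / real p ^ k"
    using inverse_p_power_mono[OF assms(2)] by (simp only: av_minus_commute)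
  then show ?thesis
    using False by simp
qed

text \<open>Modulo \<open>p ^ H\<close> the product over \<open>K\<close> of
  \<open>1 - G i X ^ Q\<close> is the indicator of a solution, so its sum over all points is the
  number of solutions to that precision. Expanding over subsets of \<open>K\<close> leaves the sums
  treated in \<open>av_sum_prod_power_le\<close>.\<close>

theorem ax_katz:
  fixes A :: "'c \<Rightarrow> 'b set" and c :: "'c \<Rightarrow> 'b \<Rightarrow> 'a" and w :: "'c \<Rightarrow> 'b \<Rightarrow> nat \<Rightarrow> nat"
  assumes K: "finite K" and A: "\<And>i. i \<in> K \<Longrightarrow> finite (A i)"
    and c: "\<And>i x. i \<in> K \<Longrightarrow> x \<in> A i \<Longrightarrow> av (c i x) \<le> 1"
    and w: "\<And>i x. i \<in> K \<Longrightarrow> x \<in> A i \<Longrightarrow> (\<Sum>j\<in>{1..n}. w i x j) \<le> D i"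
    and D: "\<And>i. i \<in> K \<Longrightarrow> D i \<le> \<Delta>" "\<Delta> \<ge> 1"
    and t: "\<Delta> * t + (\<Sum>i\<in>K. D i) < n"
  shows "p ^ (h * (t + 1)) dvd card {X \<in> {1..n} \<rightarrow>\<^sub>E teich (p ^ h).
    \<forall>i\<in>K. av (\<Sum>x\<in>A i. c i x * (\<Prod>j\<in>{1..n}. X j ^ w i x j)) \<le> 1 / real p}"
proof -
  define T where "T = {1..n} \<rightarrow>\<^sub>E (teich (p ^ h) :: 'a set)"
  define H where "H = h * (t + 1)"
  \<comment> \<open>The wanted divisibility \<open>H\<close> is also used as the power of
    \<open>p\<close> in the exponent; the indicator is then correct modulo \<open>p ^ Suc H\<close>,
    more than enough.\<close>
  define Q where "Q = (p ^ h - 1) * p ^ H"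
  define G where "G i X = (\<Sum>x\<in>A i. c i x * (\<Prod>j\<in>{1..n}. X j ^ w i x j))" for i X
  have "finite T"
    unfolding T_def by (intro finite_PiE) (auto simp: finite_teich)
  have G: "av (G i X) \<le> 1" if "i \<in> K" "X \<in> T" for i X
  proof -
    have "av (\<Prod>j\<in>{1..n}. X j ^ w i x j) \<le> 1" for x
      using that(2) by (intro av_prod_le_1 av_power_le_1 av_teich_le_1) (auto simp: T_def)
    then show ?thesis
      unfolding G_def using that(1) c by (intro av_sum_le av_mult_le_left) auto
  qed
  have close: "av ((\<Prod>i\<in>K. 1 - G i X ^ Q) - (\<Prod>i\<in>K. of_bool (av (G i X) \<le> 1 / real p))) \<le> 1 / real p ^ H"
    if X: "X \<in> T" for X
  proof (rule av_prod_diff_le)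
    fix i assume i: "i \<in> K"
    show "av (1 - G i X ^ Q) \<le> 1"
      by (rule av_diff_le) (simp_all add: av_power_le_1 G[OF i X])
    show "av (of_bool (av (G i X) \<le> 1 / real p)) \<le> 1"
      by (simp add: of_bool_def)
    show "av (1 - G i X ^ Q - of_bool (av (G i X) \<le> 1 / real p)) \<le> 1 / real p ^ H"
      unfolding Q_def using G[OF i X] by (intro power_indicator_close) auto
  qed simp
  have "(\<Prod>i\<in>K. of_bool (av (G i X) \<le> 1 / real p)) = (of_bool (\<forall>i\<in>K. av (G i X) \<le> 1 / real p) :: 'a)" for X
    using K by (induction K rule: finite_induct) auto
  then have "(\<Sum>X\<in>T. \<Prod>i\<in>K. of_bool (av (G i X) \<le> 1 / real p)) =
      (of_nat (card {X \<in> T. \<forall>i\<in>K. av (G i X) \<le> 1 / real p}) :: 'a)"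
    using \<open>finite T\<close> by (simp add: sum.If_cases Int_def of_bool_def)
  moreover have "av ((\<Sum>X\<in>T. \<Prod>i\<in>K. 1 - G i X ^ Q) - (\<Sum>X\<in>T. \<Prod>i\<in>K. of_bool (av (G i X) \<le> 1 / real p)))
      \<le> 1 / real p ^ H"
    unfolding sum_subtractf[symmetric] using close by (intro av_sum_le) auto
  moreover have "av (\<Sum>X\<in>T. \<Prod>i\<in>K. 1 - G i X ^ Q) \<le> 1 / real p ^ H"
  proof -
    have "(\<Sum>X\<in>T. \<Prod>i\<in>K. 1 - G i X ^ Q) = (\<Sum>X\<in>T. \<Prod>i\<in>K. (- 1) * G i X ^ Q + 1)"
      by (simp add: algebra_simps)
    also have "\<dots> = (\<Sum>X\<in>T. \<Sum>S\<in>Pow K. (- 1) ^ card S * (\<Prod>i\<in>S. G i X ^ Q))"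
      unfolding prod_add[OF K] by (simp only: prod.distrib prod_constant prod.neutral_const power_one mult_1_right)
    also have "\<dots> = (\<Sum>S\<in>Pow K. (- 1) ^ card S * (\<Sum>X\<in>T. \<Prod>i\<in>S. G i X ^ Q))"
      unfolding sum_distrib_left by (rule sum.swap)
    also have "av \<dots> \<le> 1 / real p ^ H"
    proof (rule av_sum_le)
      fix S assume S: "S \<in> Pow K"
      \<comment> \<open>Dropping conditions can only lower the sum of the degrees, so the same
        \<open>t\<close> and \<open>\<Delta>\<close> serve for every subset.\<close>
      then have "(\<Sum>i\<in>S. D i) \<le> (\<Sum>i\<in>K. D i)"
        using K by (intro sum_mono2) auto
      then have "\<Delta> * t + (\<Sum>i\<in>S. D i) < n"
        using t by linarith
      then have "av (\<Sum>X\<in>T. \<Prod>i\<in>S. G i X ^ Q) \<le> 1 / real p ^ H"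
        unfolding T_def G_def Q_def H_def using S K A c w D finite_subset[of S K]
        by (intro av_sum_prod_power_le[where D = D and \<Delta> = \<Delta>]) auto
      then show "av ((- 1) ^ card S * (\<Sum>X\<in>T. \<Prod>i\<in>S. G i X ^ Q)) \<le> 1 / real p ^ H"
        by (intro av_mult_le_left av_power_le_1) auto
    qed simp
    finally show ?thesis .
  qed
  ultimately have "av (of_nat (card {X \<in> T. \<forall>i\<in>K. av (G i X) \<le> 1 / real p})) \<le> 1 / real p ^ H"
    using av_diff_le by fastforce
  then show ?thesis
    unfolding T_def G_def H_def by (rule dvd_of_av_of_nat_le)
qed

end

section \<open>Reduction to Witt components\<close>

context unramified_padic_extension
begin

lemma teich_mult: "x \<in> teich (p ^ h) \<Longrightarrow> y \<in> teich (p ^ h) \<Longrightarrow> x * y \<in> (teich (p ^ h) :: 'a set)"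
  by (auto simp: teich_def power_mult_distrib)

lemma teich_1: "1 \<in> (teich (p ^ h) :: 'a set)"
  by (simp add: teich_def)

lemma teich_power: "x \<in> teich (p ^ h) \<Longrightarrow> x ^ k \<in> (teich (p ^ h) :: 'a set)"
  by (induction k) (auto intro: teich_mult teich_1)

lemma teich_prod: "(\<And>x. x \<in> A \<Longrightarrow> f x \<in> teich (p ^ h)) \<Longrightarrow> (\<Prod>x\<in>A. f x) \<in> (teich (p ^ h) :: 'a set)"
  by (induction A rule: infinite_finite_induct) (auto intro: teich_mult teich_1)

lemma teich_power_q_power:
  fixes x :: 'a
  assumes "x \<in> teich (p ^ h)"
  shows "x ^ (p ^ (h * k)) = x"
proof (induction k)
  case (Suc k)
  have "x ^ (p ^ h) = x"
  proof (cases "x = 0")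
    case False
    then have "x ^ (p ^ h - 1) = 1"
      using assms by (auto simp: teich_def)
    then show ?thesis
      using power_minus_mult[of "p ^ h" x] p_ge_2 by simp
  qed (use p_ge_2 in auto)
  have "x ^ (p ^ (h * Suc k)) = (x ^ (p ^ h)) ^ (p ^ (h * k))"
    by (simp add: power_add power_mult)
  then show ?case
    using \<open>x ^ (p ^ h) = x\<close> Suc by simp
qed auto

lemma teich_series_tail:
  fixes a :: "nat \<Rightarrow> 'a"
  assumes "\<And>i. a i \<in> teich (p ^ h)" "(\<lambda>i. of_nat p ^ i * a i) sums c"
  shows "av (c - (\<Sum>i<m. of_nat p ^ i * a i)) \<le> 1 / real p ^ m"
proof -
  define S where "S n = (\<Sum>i<n. of_nat p ^ i * a i)" for n
  have "1 / real p ^ m > 0"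
    using p_ge_2 by simp
  then obtain M where M: "\<And>n. n \<ge> M \<Longrightarrow> dist (S n) c < 1 / real p ^ m"
    using assms(2) unfolding sums_def S_def lim_sequentially by blast
  define n where "n = max M m"
  have "S n - S m = (\<Sum>i\<in>{..<n} - {..<m}. of_nat p ^ i * a i)"
    unfolding S_def by (subst sum_diff) (auto simp: n_def)
  also have "av \<dots> \<le> 1 / real p ^ m"
  proof (rule av_sum_le)
    fix i assume "i \<in> {..<n} - {..<m}"
    then have "1 / real p ^ i \<le> 1 / real p ^ m"
      by (intro inverse_p_power_mono) auto
    moreover have "av (of_nat p ^ i * a i) \<le> 1 / real p ^ i * 1"
      by (intro av_mult_le av_teich_le_1 assms) (simp add: av_of_nat_p_power)
    ultimately show "av (of_nat p ^ i * a i) \<le> 1 / real p ^ m"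
      by simp
  qed simp
  finally have "av (S n - S m) \<le> 1 / real p ^ m" .
  moreover have "av (c - S n) \<le> 1 / real p ^ m"
    using M[of n] by (simp add: n_def dist_av av_minus_commute)
  ultimately show ?thesis
    using av_diff_le_trans unfolding S_def by blast
qed

text \<open>The first nonzero \<open>a r\<close> would be a unit, and the sum would have absolute
  value \<open>1 / p ^ r\<close>. Consequently a monomial absent from a polynomial is absent from
  all terms of its expansion.\<close>

lemma teich_series_eq_0:
  fixes a :: "nat \<Rightarrow> 'a"
  assumes a: "\<And>i. a i \<in> teich (p ^ h)" and "(\<lambda>i. of_nat p ^ i * a i) sums 0"
  shows "a r = 0"
proof (induction r rule: less_induct)
  case (less r)
  have "(\<Sum>i<Suc r. of_nat p ^ i * a i) = of_nat p ^ r * a r"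
    using less by simp
  then have "av (of_nat p ^ r * a r) \<le> 1 / real p ^ Suc r"
    using teich_series_tail[OF assms, of "Suc r"] by simp
  then have "av (a r) \<le> 1 / real p"
    using p_ge_2 by (simp add: av_mult av_of_nat_p_power field_simps)
  then have "av (a r) \<noteq> 1"
    using inverse_p_less_1 by simp
  then show ?case
    using av_teich[OF a] by blast
qed

lemma divisible_iff_av_le:
  "(\<exists>y\<in>ring_of_integers av. z = of_nat p ^ m * y) \<longleftrightarrow> av z \<le> 1 / real p ^ m"
proof
  assume "\<exists>y\<in>ring_of_integers av. z = of_nat p ^ m * y"
  then obtain y where "av y \<le> 1" "z = of_nat p ^ m * y"
    by (auto simp: ring_of_integers_def)
  then show "av z \<le> 1 / real p ^ m"
    using av_mult_le[of "of_nat p ^ m" "1 / real p ^ m" y 1] by (simp add: av_of_nat_p_power)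
next
  assume z: "av z \<le> 1 / real p ^ m"
  have nz: "(of_nat p ^ m :: 'a) \<noteq> 0"
    using p_ge_2 by simp
  then have "av (z / of_nat p ^ m) \<le> 1"
    using z p_ge_2 by (simp add: av_divide av_of_nat_p_power field_simps)
  then show "\<exists>y\<in>ring_of_integers av. z = of_nat p ^ m * y"
    using nz by (intro bexI[of _ "z / of_nat p ^ m"]) (auto simp: ring_of_integers_def)
qed

lemma mpol_eval_eq:
  assumes "\<And>\<mu>. \<mu> \<in> Poly_Mapping.keys f \<Longrightarrow> Poly_Mapping.keys \<mu> \<subseteq> {1..n}"
  shows "mpol_eval f X =
    (\<Sum>\<mu>\<in>Poly_Mapping.keys f. Poly_Mapping.lookup f \<mu> * (\<Prod>j\<in>{1..n}. X j ^ Poly_Mapping.lookup \<mu> j))"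
  unfolding mpol_eval_def
proof (intro sum.cong refl arg_cong2[where f = "(*)"] prod.mono_neutral_left)
  fix \<mu> assume "\<mu> \<in> Poly_Mapping.keys f"
  then show "Poly_Mapping.keys \<mu> \<subseteq> {1..n}"
    by (rule assms)
qed (auto simp: in_keys_iff)

text \<open>As \<open>x ^ q = x\<close> on Teichmueller points, the \<open>i\<close>-th Teichmueller term, which has Witt weight
  \<open>p ^ i\<close>, may be entered as its \<open>p ^ (i mod h)\<close>-th power.\<close>

lemma witt_reduction:
  fixes f :: "'a mpol" and F :: "nat \<Rightarrow> 'a mpol"
  assumes f: "f \<in> mpols (ring_of_integers av) n" and F: "teich_expansion p h f F"
    and deg: "\<And>i. i < m \<Longrightarrow> total_degree (F i) \<le> d * p ^ (h * (i div h))"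
  obtains A :: "nat \<Rightarrow> (nat \<times> (nat \<Rightarrow>\<^sub>0 nat) \<Rightarrow>\<^sub>0 nat) set" and c w where
    "\<And>e. e < m \<Longrightarrow> finite (A e)"
    "\<And>e x. e < m \<Longrightarrow> x \<in> A e \<Longrightarrow> av (c e x) \<le> 1"
    "\<And>e x. e < m \<Longrightarrow> x \<in> A e \<Longrightarrow> (\<Sum>j\<in>{1..n}. w e x j) \<le> d * p ^ e"
    "\<And>X. X \<in> {1..n} \<rightarrow>\<^sub>E teich (p ^ h) \<Longrightarrow>
      (\<exists>y\<in>ring_of_integers av. mpol_eval f X = of_nat p ^ m * y) \<longleftrightarrow>
      (\<forall>e<m. av (\<Sum>x\<in>A e. c e x * (\<Prod>j\<in>{1..n}. X j ^ w e x j)) \<le> 1 / real p)"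
proof -
  have F_teich: "Poly_Mapping.lookup (F i) \<mu> \<in> teich (p ^ h)" for i \<mu>
    using F by (auto simp: teich_expansion_def teich_poly_def)
  have F_sums: "(\<lambda>i. of_nat p ^ i * Poly_Mapping.lookup (F i) \<mu>) sums Poly_Mapping.lookup f \<mu>" for \<mu>
    using F by (simp add: teich_expansion_def)
  \<comment> \<open>The support of \<open>f\<close> is a common finite set of monomials for all
    \<open>F i\<close>, and it confines their variables to \<open>{1..n}\<close>.\<close>
  have keys_F: "Poly_Mapping.keys (F i) \<subseteq> Poly_Mapping.keys f" for i
  proof
    fix \<mu> assume \<mu>: "\<mu> \<in> Poly_Mapping.keys (F i)"
    show "\<mu> \<in> Poly_Mapping.keys f"
    proof (rule ccontr)
      assume "\<mu> \<notin> Poly_Mapping.keys f"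
      then have "(\<lambda>i. of_nat p ^ i * Poly_Mapping.lookup (F i) \<mu>) sums 0"
        using F_sums[of \<mu>] by (simp add: in_keys_iff)
      then have "Poly_Mapping.lookup (F i) \<mu> = 0"
        by (rule teich_series_eq_0[OF F_teich])
      then show False
        using \<mu> by (simp add: in_keys_iff)
    qed
  qed
  have vars: "Poly_Mapping.keys \<mu> \<subseteq> {1..n}" if "\<mu> \<in> Poly_Mapping.keys f" for \<mu>
    using f that by (auto simp: mpols_def)
  \<comment> \<open>A multiple of \<open>h\<close>, so that for a term of index \<open>i\<close> the
    exponents \<open>p ^ (i mod h)\<close> and \<open>p ^ (N - i)\<close> multiply to a power of
    \<open>q\<close>, which fixes Teichmueller representatives. It is at least \<open>m\<close>, so
    that every index \<open>i < m\<close> occurs in \<open>ghost N\<close>.\<close>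
  define N where "N = h * m"
  have "1 * m \<le> h * m"
    using h_pos by (intro mult_right_mono) auto
  then have mN: "m \<le> N"
    by (simp add: N_def)
  \<comment> \<open>One variable for each Teichmueller term, that is, for each index
    \<open>i < m\<close> and each monomial of \<open>F i\<close>.\<close>
  define L where "L = (SIGMA i:{..<m}. Poly_Mapping.keys (F i))"
  have L_D: "fst l < m" "snd l \<in> Poly_Mapping.keys (F (fst l))" if "l \<in> L" for l
    using that by (auto simp: L_def)
  interpret W: witt_variables p L fst
    by unfold_locales (auto simp: prime_p L_def)
  obtain s where s: "\<And>r. r \<le> N \<Longrightarrow> W.ghost r = (\<Sum>e\<le>r. of_nat p ^ e * s e ^ (p ^ (r - e)))"
    "\<And>e. e \<le> N \<Longrightarrow> W.weight_le (p ^ e) (s e)"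
    using W.witt_components by blast
  define a where "a l = Poly_Mapping.lookup (F (fst l)) (snd l)" for l
  define k where "k l = p ^ (fst l mod h)" for l :: "nat \<times> (nat \<Rightarrow>\<^sub>0 nat)"
  define mon where "mon X \<mu> = (\<Prod>j\<in>{1..n}. X j ^ Poly_Mapping.lookup \<mu> j)" for X :: "nat \<Rightarrow> 'a" and \<mu>
  define u where "u X l = (a l * mon X (snd l)) ^ k l" for X l
  define \<phi> where "\<phi> X \<mu> = (\<Prod>l\<in>L. u X l ^ Poly_Mapping.lookup \<mu> l)" for X \<mu>
  define S where "S X e = int_poly_eval (\<phi> X) (s e)" for X e
  define c where "c e \<mu> = of_int (Poly_Mapping.lookup (s e) \<mu>) *
    (\<Prod>l\<in>L. a l ^ (k l * Poly_Mapping.lookup \<mu> l))" for e \<mu>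
  define w where "w \<mu> j = (\<Sum>l\<in>L. Poly_Mapping.lookup (snd l) j * (k l * Poly_Mapping.lookup \<mu> l))"
    for \<mu> :: "nat \<times> (nat \<Rightarrow>\<^sub>0 nat) \<Rightarrow>\<^sub>0 nat" and j
  have \<phi>: "monomial_valuation (\<phi> X)" for X
    by unfold_locales (simp_all add: \<phi>_def lookup_add power_add prod.distrib)
  have \<phi>_var: "int_poly_eval (\<phi> X) (W.var l) = u X l" if "l \<in> L" for X l
  proof -
    have "(\<Prod>l'\<in>L - {l}. u X l' ^ Poly_Mapping.lookup (Poly_Mapping.single l 1) l') = 1"
      by (intro prod.neutral) (auto simp: lookup_single when_def)
    then have "\<phi> X (Poly_Mapping.single l 1) = u X l"
      using W.finite_L that prod.remove[of L l "\<lambda>l'. u X l' ^ Poly_Mapping.lookup (Poly_Mapping.single l 1) l'"]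
      by (simp add: \<phi>_def)
    then show ?thesis
      by (simp add: W.var_def)
  qed
  have S_eq: "S X e = (\<Sum>\<mu>\<in>Poly_Mapping.keys (s e). c e \<mu> * (\<Prod>j\<in>{1..n}. X j ^ w \<mu> j))" for X e
  proof -
    have "\<phi> X \<mu> = (\<Prod>l\<in>L. a l ^ (k l * Poly_Mapping.lookup \<mu> l)) * (\<Prod>j\<in>{1..n}. X j ^ w \<mu> j)" for \<mu>
    proof -
      have "(\<Prod>l\<in>L. mon X (snd l) ^ (k l * Poly_Mapping.lookup \<mu> l)) =
          (\<Prod>l\<in>L. \<Prod>j\<in>{1..n}. X j ^ (Poly_Mapping.lookup (snd l) j * (k l * Poly_Mapping.lookup \<mu> l)))"
        by (simp only: mon_def prod_power_distrib power_mult)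
      also have "\<dots> = (\<Prod>j\<in>{1..n}. X j ^ w \<mu> j)"
        unfolding w_def power_sum by (rule prod.swap)
      finally show ?thesis
        by (simp add: \<phi>_def u_def power_mult[symmetric] power_mult_distrib prod.distrib)
    qed
    then show ?thesis
      by (simp add: S_def int_poly_eval_def c_def mult.assoc)
  qed
  have c_le: "av (c e \<mu>) \<le> 1" for e \<mu>
  proof -
    have "av (\<Prod>l\<in>L. a l ^ (k l * Poly_Mapping.lookup \<mu> l)) \<le> 1"
      by (intro av_prod_le_1 av_power_le_1 av_teich_le_1) (simp add: a_def F_teich)
    then show ?thesis
      unfolding c_def by (intro av_mult_le_left av_of_int_le_1)
  qed
  have w_le: "(\<Sum>j\<in>{1..n}. w \<mu> j) \<le> d * p ^ e" if e: "e < m" and \<mu>: "\<mu> \<in> Poly_Mapping.keys (s e)" for e \<mu>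
  proof -
    have "(\<Sum>j\<in>{1..n}. w \<mu> j) =
        (\<Sum>l\<in>L. (\<Sum>j\<in>{1..n}. Poly_Mapping.lookup (snd l) j) * (k l * Poly_Mapping.lookup \<mu> l))"
      unfolding w_def sum_distrib_right by (rule sum.swap)
    also have "\<dots> \<le> (\<Sum>l\<in>L. d * p ^ (h * (fst l div h)) * (k l * Poly_Mapping.lookup \<mu> l))"
    proof (intro sum_mono mult_right_mono)
      fix l assume l: "l \<in> L"
      have "(\<Sum>j\<in>{1..n}. Poly_Mapping.lookup (snd l) j) = (\<Sum>j\<in>Poly_Mapping.keys (snd l). Poly_Mapping.lookup (snd l) j)"
      proof (rule sum.mono_neutral_right)
        show "Poly_Mapping.keys (snd l) \<subseteq> {1..n}"
          using keys_F L_D(2)[OF l] by (intro vars) blast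
      qed (auto simp: in_keys_iff)
      also have "\<dots> \<le> total_degree (F (fst l))"
        unfolding total_degree_def using L_D(2)[OF l] by (intro Max_ge) auto
      also have "\<dots> \<le> d * p ^ (h * (fst l div h))"
        by (intro deg L_D l)
      finally show "(\<Sum>j\<in>{1..n}. Poly_Mapping.lookup (snd l) j) \<le> d * p ^ (h * (fst l div h))" .
    qed simp
    \<comment> \<open>The power \<open>k l = p ^ (i mod h)\<close> raises the degree bound
      \<open>d * p ^ (h * (i div h))\<close> of a term of index \<open>i\<close> to
      \<open>d * p ^ i\<close>, which is \<open>d\<close> times the weight of its variable. The
      factor missing in the degree hypothesis is thus the one that the power adds.\<close>
    also have "\<dots> = d * W.weight \<mu>"
    proof -
      have "p ^ (h * (fst l div h)) * k l = p ^ fst l" for l :: "nat \<times> (nat \<Rightarrow>\<^sub>0 nat)"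
        unfolding k_def power_add[symmetric] by simp
      then have "d * p ^ (h * (fst l div h)) * (k l * Poly_Mapping.lookup \<mu> l) =
          d * (Poly_Mapping.lookup \<mu> l * p ^ fst l)" for l
        by (metis mult.assoc mult.commute)
      then show ?thesis
        by (simp only: W.weight_def sum_distrib_left)
    qed
    also have "\<dots> \<le> d * p ^ e"
      using s(2)[of e] e mN \<mu> by (intro mult_left_mono) (auto simp: W.weight_le_def)
    finally show ?thesis .
  qed
  have main: "(\<exists>y\<in>ring_of_integers av. mpol_eval f X = of_nat p ^ m * y) \<longleftrightarrow> (\<forall>e<m. av (S X e) \<le> 1 / real p)"
    if X: "X \<in> {1..n} \<rightarrow>\<^sub>E teich (p ^ h)" for X
  proof -
    interpret \<phi>: monomial_valuation "\<phi> X"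
      by (rule \<phi>)
    have mon: "mon X \<mu> \<in> teich (p ^ h)" for \<mu>
      unfolding mon_def using X by (intro teich_prod teich_power) auto
    have S_le: "av (S X e) \<le> 1" for e
    proof -
      have "av (\<Prod>j\<in>{1..n}. X j ^ w \<mu> j) \<le> 1" for \<mu>
        using X by (intro av_prod_le_1 av_power_le_1 av_teich_le_1) auto
      then show ?thesis
        unfolding S_eq by (intro av_sum_le av_mult_le_left c_le) auto
    qed
    \<comment> \<open>\<open>z\<close> is \<open>f(X)\<close> cut off modulo \<open>p ^ m\<close>.
      It is the value of \<open>ghost N\<close> at the powers \<open>u X l\<close>, which is why
      \<open>witt_vanishing_iff\<close> applies to it.\<close>
    define z where "z = (\<Sum>l\<in>L. of_nat p ^ fst l * (a l * mon X (snd l)))"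
    have "(\<Sum>e\<le>N. of_nat p ^ e * S X e ^ (p ^ (N - e))) = int_poly_eval (\<phi> X) (W.ghost N)"
      unfolding s(1)[OF order_refl] by (simp add: \<phi>.eval_hom S_def)
    also have "\<dots> = (\<Sum>l\<in>{l \<in> L. fst l \<le> N}. of_nat p ^ fst l * u X l ^ (p ^ (N - fst l)))"
      unfolding W.ghost_def \<phi>.eval_hom using \<phi>_var by (intro sum.cong) auto
    also have "{l \<in> L. fst l \<le> N} = L"
      using L_D(1) mN by fastforce
    also have "(\<Sum>l\<in>L. of_nat p ^ fst l * u X l ^ (p ^ (N - fst l))) = z"
      unfolding z_def
    proof (intro sum.cong refl arg_cong2[where f = "(*)"])
      fix l assume l: "l \<in> L"
      have "fst l div h \<le> m"
        using L_D(1)[OF l] div_le_dividend[of "fst l" h] by linarith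
      moreover have "fst l \<le> N"
        using L_D(1)[OF l] mN by linarith
      moreover have "fst l = h * (fst l div h) + fst l mod h"
        by simp
      ultimately have "fst l mod h + (N - fst l) = h * (m - fst l div h)"
        unfolding N_def diff_mult_distrib2 by linarith
      then have "k l * p ^ (N - fst l) = p ^ (h * (m - fst l div h))"
        by (simp add: k_def power_add[symmetric])
      then have "u X l ^ (p ^ (N - fst l)) = (a l * mon X (snd l)) ^ (p ^ (h * (m - fst l div h)))"
        by (simp only: u_def power_mult[symmetric])
      also have "\<dots> = a l * mon X (snd l)"
        by (intro teich_power_q_power teich_mult mon) (simp add: a_def F_teich)
      finally show "u X l ^ (p ^ (N - fst l)) = a l * mon X (snd l)" .
    qed
    finally have z: "av z \<le> 1 / real p ^ m \<longleftrightarrow> (\<forall>e<m. av (S X e) \<le> 1 / real p)"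
      using witt_vanishing_iff[of N "S X" m] S_le mN by simp
    have "z = (\<Sum>i<m. \<Sum>\<mu>\<in>Poly_Mapping.keys (F i). of_nat p ^ i * (Poly_Mapping.lookup (F i) \<mu> * mon X \<mu>))"
      unfolding z_def L_def a_def by (subst sum.Sigma) (auto simp: case_prod_beta)
    also have "\<dots> = (\<Sum>i<m. \<Sum>\<mu>\<in>Poly_Mapping.keys f. of_nat p ^ i * (Poly_Mapping.lookup (F i) \<mu> * mon X \<mu>))"
      using keys_F by (intro sum.cong refl sum.mono_neutral_left) (auto simp: in_keys_iff)
    also have "\<dots> = (\<Sum>\<mu>\<in>Poly_Mapping.keys f. mon X \<mu> * (\<Sum>i<m. of_nat p ^ i * Poly_Mapping.lookup (F i) \<mu>))"
      unfolding sum_distrib_left by (subst sum.swap) (simp add: mult_ac)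
    finally have "mpol_eval f X - z = (\<Sum>\<mu>\<in>Poly_Mapping.keys f. mon X \<mu> *
        (Poly_Mapping.lookup f \<mu> - (\<Sum>i<m. of_nat p ^ i * Poly_Mapping.lookup (F i) \<mu>)))"
      using vars by (subst mpol_eval_eq[of f n]) (auto simp: mon_def sum_subtractf right_diff_distrib mult.commute)
    also have "av \<dots> \<le> 1 / real p ^ m"
      by (intro av_sum_le av_mult_le_left av_teich_le_1 mon teich_series_tail F_teich F_sums) simp
    finally have diff: "av (mpol_eval f X - z) \<le> 1 / real p ^ m" .
    have "av (mpol_eval f X) \<le> 1 / real p ^ m \<longleftrightarrow> av z \<le> 1 / real p ^ m"
    proof
      assume "av (mpol_eval f X) \<le> 1 / real p ^ m"
      from av_diff_le[OF this diff] show "av z \<le> 1 / real p ^ m"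
        by simp
    next
      assume "av z \<le> 1 / real p ^ m"
      from av_add_le[OF this diff] show "av (mpol_eval f X) \<le> 1 / real p ^ m"
        by simp
    qed
    then show ?thesis
      unfolding divisible_iff_av_le using z by simp
  qed
  show ?thesis
  proof (rule that[of "\<lambda>e. Poly_Mapping.keys (s e)" c "\<lambda>_. w"])
    show "(\<exists>y\<in>ring_of_integers av. mpol_eval f X = of_nat p ^ m * y) \<longleftrightarrow>
        (\<forall>e<m. av (\<Sum>x\<in>Poly_Mapping.keys (s e). c e x * (\<Prod>j\<in>{1..n}. X j ^ w x j)) \<le> 1 / real p)"
      if "X \<in> {1..n} \<rightarrow>\<^sub>E teich (p ^ h)" for X
      using main[OF that] unfolding S_eq .
  qed (use c_le w_le in auto)
qed

text \<open>Each condition modulo \<open>p ^ m k\<close> becomes \<open>m k\<close> conditions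
  modulo \<open>p\<close>, of degrees at most \<open>d k * p ^ e\<close> for \<open>e < m k\<close>.
  The pairs of \<open>k\<close> and \<open>e\<close> index the system to which
  \<open>ax_katz\<close> is applied.\<close>

lemma card_solutions_dvd:
  fixes f :: "nat \<Rightarrow> 'a mpol"
  assumes f: "\<And>k. k \<in> {1..s} \<Longrightarrow> f k \<in> mpols (ring_of_integers av) n"
    and F: "\<And>k. k \<in> {1..s} \<Longrightarrow> teich_expansion p h (f k) (F k)"
    and deg: "\<And>k i. k \<in> {1..s} \<Longrightarrow> i < m k \<Longrightarrow> total_degree (F k i) \<le> d k * p ^ (h * (i div h))"
    and \<Delta>: "\<And>k e. k \<in> {1..s} \<Longrightarrow> e < m k \<Longrightarrow> d k * p ^ e \<le> \<Delta>" "\<Delta> \<ge> 1"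
    and t: "\<Delta> * t + (\<Sum>k\<in>{1..s}. \<Sum>e<m k. d k * p ^ e) < n"
  shows "p ^ (h * (t + 1)) dvd card (solutions av p h n s f m)"
proof -
  \<comment> \<open>Bundling the conclusions of \<open>witt_reduction\<close> into one predicate
    allows \<open>A\<close>, \<open>c\<close> and \<open>w\<close> to be chosen for all
    \<open>k\<close> at once.\<close>
  define P where "P k A c w \<longleftrightarrow> (\<forall>e<m k. finite (A e) \<and>
      (\<forall>x\<in>A e. av (c e x) \<le> 1 \<and> (\<Sum>j\<in>{1..n}. w e x j) \<le> d k * p ^ e)) \<and>
      (\<forall>X\<in>{1..n} \<rightarrow>\<^sub>E teich (p ^ h). (\<exists>y\<in>ring_of_integers av. mpol_eval (f k) X = of_nat p ^ m k * y) \<longleftrightarrow>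
        (\<forall>e<m k. av (\<Sum>x\<in>A e. c e x * (\<Prod>j\<in>{1..n}. X j ^ w e x j)) \<le> 1 / real p))"
    for k and A :: "nat \<Rightarrow> (nat \<times> (nat \<Rightarrow>\<^sub>0 nat) \<Rightarrow>\<^sub>0 nat) set" and c w
  have "\<exists>A c w. P k A c w" if k: "k \<in> {1..s}" for k
  proof (rule witt_reduction[OF f[OF k] F[OF k] deg[OF k]])
    fix A :: "nat \<Rightarrow> (nat \<times> (nat \<Rightarrow>\<^sub>0 nat) \<Rightarrow>\<^sub>0 nat) set" and c w
    assume "\<And>e. e < m k \<Longrightarrow> finite (A e)" "\<And>e x. e < m k \<Longrightarrow> x \<in> A e \<Longrightarrow> av (c e x) \<le> 1"
      "\<And>e x. e < m k \<Longrightarrow> x \<in> A e \<Longrightarrow> (\<Sum>j\<in>{1..n}. w e x j) \<le> d k * p ^ e"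
      "\<And>X. X \<in> {1..n} \<rightarrow>\<^sub>E teich (p ^ h) \<Longrightarrow>
        (\<exists>y\<in>ring_of_integers av. mpol_eval (f k) X = of_nat p ^ m k * y) \<longleftrightarrow>
        (\<forall>e<m k. av (\<Sum>x\<in>A e. c e x * (\<Prod>j\<in>{1..n}. X j ^ w e x j)) \<le> 1 / real p)"
    then have "P k A c w"
      unfolding P_def by blast
    then show ?thesis
      by blast
  qed
  then obtain A c w where P: "\<And>k. k \<in> {1..s} \<Longrightarrow> P k (A k) (c k) (w k)"
    by metis
  note P' = P[unfolded P_def]
  define K where "K = (SIGMA k:{1..s}. {..<m k})"
  have "solutions av p h n s f m = {X \<in> {1..n} \<rightarrow>\<^sub>E teich (p ^ h). \<forall>i\<in>K.
      av (\<Sum>x\<in>A (fst i) (snd i). c (fst i) (snd i) x * (\<Prod>j\<in>{1..n}. X j ^ w (fst i) (snd i) x j)) \<le> 1 / real p}"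
  proof (unfold solutions_def, intro Collect_cong conj_cong refl)
    fix X :: "nat \<Rightarrow> 'a"
    assume "X \<in> {1..n} \<rightarrow>\<^sub>E teich (p ^ h)"
    then have "(\<forall>k\<in>{1..s}. \<exists>y\<in>ring_of_integers av. mpol_eval (f k) X = of_nat p ^ m k * y) \<longleftrightarrow>
        (\<forall>k\<in>{1..s}. \<forall>e<m k. av (\<Sum>x\<in>A k e. c k e x * (\<Prod>j\<in>{1..n}. X j ^ w k e x j)) \<le> 1 / real p)"
      using P' by (intro ball_cong refl) blast
    then show "(\<forall>k\<in>{1..s}. \<exists>y\<in>ring_of_integers av. mpol_eval (f k) X = of_nat p ^ m k * y) \<longleftrightarrow>
        (\<forall>i\<in>K. av (\<Sum>x\<in>A (fst i) (snd i). c (fst i) (snd i) x *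
          (\<Prod>j\<in>{1..n}. X j ^ w (fst i) (snd i) x j)) \<le> 1 / real p)"
      by (simp only:) (auto simp: K_def)
  qed
  also have "p ^ (h * (t + 1)) dvd card \<dots>"
  proof (rule ax_katz[where D = "\<lambda>i. d (fst i) * p ^ snd i" and \<Delta> = \<Delta>])
    have "(\<Sum>i\<in>K. d (fst i) * p ^ snd i) = (\<Sum>k\<in>{1..s}. \<Sum>e<m k. d k * p ^ e)"
      unfolding K_def by (subst sum.Sigma) (auto simp: case_prod_beta)
    then show "\<Delta> * t + (\<Sum>i\<in>K. d (fst i) * p ^ snd i) < n"
      using t by simp
  qed (use P' \<Delta> in \<open>auto simp: K_def\<close>)
  finally show ?thesis .
qed

end

lemma less_of_ceiling_star_eq_Suc:
  assumes "ceiling_star r = Suc t"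
  shows "real t < r"
proof (rule ccontr)
  assume "\<not> real t < r"
  then have "ceiling_star r \<le> t"
    unfolding ceiling_star_def by (intro Least_le) simp
  then show False
    using assms by simp
qed

theorem theorem3p4:
  fixes p h n s :: nat
    and av :: "'a::{field_char_0, complete_space} \<Rightarrow> real"
    and f :: "nat \<Rightarrow> 'a mpol"
    and F :: "nat \<Rightarrow> nat \<Rightarrow> 'a mpol"
    and m d :: "nat \<Rightarrow> nat"
  assumes "unramified_padic_extension p h av"
    and "s \<ge> 1"
    and "\<And>k. k \<in> {1..s} \<Longrightarrow> f k \<in> mpols (ring_of_integers av) n"
    and "\<And>k. k \<in> {1..s} \<Longrightarrow> f k \<noteq> 0"
    and "\<And>k. k \<in> {1..s} \<Longrightarrow> m k \<ge> 1"
    and "\<And>k. k \<in> {1..s} \<Longrightarrow> d k \<ge> 1"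
    and "\<And>k. k \<in> {1..s} \<Longrightarrow> teich_expansion p h (f k) (F k)"
    and "\<And>k i. k \<in> {1..s} \<Longrightarrow> i \<in> {0..m k - 1} \<Longrightarrow>
           total_degree (F k i) \<le> d k * p ^ (h * (i div h))"
  shows "ord_q p h (card (solutions av p h n s f m)) \<ge>
    ereal (real (ceiling_star
      ((real n - (\<Sum>k\<in>{1..s}. (real p ^ m k - 1) / (real p - 1) * real (d k)))
        / real (Max ((\<lambda>k. p ^ (m k - 1) * d k) ` {1..s})))))"
proof -
  interpret unramified_padic_extension p h av
    by fact
  \<comment> \<open>The degrees \<open>d k * p ^ e\<close> with \<open>e < m k\<close> are largest
    at \<open>e = m k - 1\<close>, which explains the maximum in the denominator; their sum
    \<open>\<Sigma>\<close> is the geometric series subtracted from \<open>n\<close>.\<close>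
  define \<Delta> where "\<Delta> = Max ((\<lambda>k. p ^ (m k - 1) * d k) ` {1..s})"
  define \<Sigma> where "\<Sigma> = (\<Sum>k\<in>{1..s}. \<Sum>e<m k. d k * p ^ e)"
  define N where "N = card (solutions av p h n s f m)"
  have le_\<Delta>: "p ^ (m k - 1) * d k \<le> \<Delta>" if "k \<in> {1..s}" for k
    unfolding \<Delta>_def using that by (intro Max_ge) auto
  have "1 \<le> p ^ (m 1 - 1) * d 1"
    using assms(2) assms(6)[of 1] p_ge_2 by simp
  also have "\<dots> \<le> \<Delta>"
    using assms(2) by (intro le_\<Delta>) simp
  finally have \<Delta>: "\<Delta> \<ge> 1" .
  have \<Sigma>: "(\<Sum>k\<in>{1..s}. (real p ^ m k - 1) / (real p - 1) * real (d k)) = real \<Sigma>"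
  proof -
    have "(real p ^ m k - 1) / (real p - 1) = (\<Sum>e<m k. real p ^ e)" for k
      using p_ge_2 geometric_sum[of "real p" "m k"] by simp
    then show ?thesis
      by (simp add: \<Sigma>_def sum_distrib_left mult.commute)
  qed
  have "ord_q p h N \<ge> ereal (real (ceiling_star ((real n - real \<Sigma>) / real \<Delta>)))"
  proof (cases "ceiling_star ((real n - real \<Sigma>) / real \<Delta>)")
    case 0
    then show ?thesis
      by (auto simp: ord_q_def)
  next
    \<comment> \<open>A starred ceiling equal to \<open>Suc t\<close> means that the quotient
      exceeds \<open>t\<close>. Cleared of its denominator, this is the strict inequality assumed in
      \<open>card_solutions_dvd\<close>.\<close>
    case (Suc t)
    then have "real t < (real n - real \<Sigma>) / real \<Delta>"
      by (rule less_of_ceiling_star_eq_Suc)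
    then have "real \<Delta> * real t + real \<Sigma> < real n"
      using \<Delta> by (simp add: field_simps)
    then have "real (\<Delta> * t + \<Sigma>) < real n"
      by simp
    then have t: "\<Delta> * t + \<Sigma> < n"
      by (simp only: of_nat_less_iff)
    have "p ^ (h * (t + 1)) dvd N"
      unfolding N_def
    proof (rule card_solutions_dvd[where F = F and d = d and \<Delta> = \<Delta>])
      show "d k * p ^ e \<le> \<Delta>" if "k \<in> {1..s}" "e < m k" for k e
      proof -
        have "p ^ e * d k \<le> p ^ (m k - 1) * d k"
          using that p_ge_2 by (intro mult_right_mono power_increasing) auto
        also have "\<dots> \<le> \<Delta>"
          by (rule le_\<Delta>[OF that(1)])
        finally show ?thesis
          by (simp only: mult.commute)
      qed
      show "total_degree (F k i) \<le> d k * p ^ (h * (i div h))" if "k \<in> {1..s}" "i < m k" for k i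
        using assms(8)[OF that(1), of i] that(2) by simp
    qed (use assms \<Delta> t in \<open>auto simp: \<Sigma>_def\<close>)
    \<comment> \<open>For \<open>N = 0\<close> the value of \<open>ord_q\<close> is infinite;
      otherwise divisibility gives a bound on the multiplicity, and \<open>ord_q\<close> divides it
      by \<open>h\<close>.\<close>
    then have le: "h * (t + 1) \<le> multiplicity p N" if "N \<noteq> 0"
      using that p_ge_2 by (intro multiplicity_geI) auto
    have "real (h * (t + 1)) \<le> real (multiplicity p N)" if "N \<noteq> 0"
      using le[OF that] by (simp only: of_nat_le_iff)
    then show ?thesis
      using Suc h_pos by (auto simp: ord_q_def field_simps)
  qed
  then show ?thesis
    unfolding \<Sigma> by (simp only: N_def \<Delta>_def)
qed

end
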